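(* Let $R$ be a Krasner hyperdomain with hyperfield of fractions $Q(R)$, let $I$ be a hyperideal of $R$, and let $V(R)$ be the set of all hypervaluation hyperdomains of $Q(R)$ which contain $R$. Then $$\overline{I} = \bigcap_{V\in V(R)} (IV\cap R).$$
   Context: A Krasner hyperring is a set $R$ with a hyperoperation $+$ (assigning to each pair $x,y$ a nonempty subset $x+y\subseteq R$) and a binary operation $\cdot$ such that: (1) $(R,+)$ is a canonical hypergroup: $+$ is associative and commutative, there is $0\in R$ with $0+x=\{x\}$ for all $x$, each $x$ has a unique opposite $-x$ with $0\in x+(-x)$, and $z\in x+y$ implies $y\in -x+z$ and $x\in z-y$; (2) $(R,\cdot)$ is a semigroup with $x\cdot 0=0\cdot x=0$; (3) $\cdot$ is distributive over $+$. Sums and products of subsets are taken as unions over elements, and $x-y=x+(-y)$. All hyperrings are commutative with unit element $1$. A hyperdomain is such a hyperring in which $ab=0$ implies $a=0$ or $b=0$; a hyperfield is one whose nonzero elements form a group under multiplication. A hyperideal of $R$ is a nonempty $I\subseteq R$ with $a-b\subseteq I$ and $ar\in I$ for all $a,b\in I$, $r\in R$. The product of hyperideals is $IJ=\{z: z\in\sum_{i=1}^n a_ib_i,\ a_i\in I,\ b_i\in J,\ n\ge 1\}$, and $I^i$ is the $i$-fold product. The integral closure $\overline{I}$ of a hyperideal $I$ of $R$ is the set of all $r\in R$ for which there are $n\ge 1$ and $a_i\in I^i$ $(1\le i\le n)$ with $0\in r^n+a_1r^{n-1}+\cdots+a_{n-1}r+a_n$. For a Krasner hyperdomain $R$, $Q(R)$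 is its quotient hyperfield (hyperfield of fractions): fractions $a/b$ with $b\ne 0$, usual equality and product, and $a/b+c/d=\{x/(bd): x\in ad+bc\}$; $R$ is regarded as a subset of $Q(R)$. A hypervaluation hyperring (hyperdomain) $V$ of $Q(R)$ is a subhyperring of $Q(R)$ such that for every nonzero $a\in Q(R)$, $a\in V$ or $a^{-1}\in V$. For $V\supseteq R$, $IV=\{z: z\in \sum_{i=1}^n a_iv_i,\ a_i\in I,\ v_i\in V,\ n\geq 1\}$. *)

theory Defs
  imports "HOL-Algebra.Group"
begin

section \<open>Krasner hyperrings\<close>

record 'a hyperring = "'a monoid" +
  hzero :: 'a  (\<open>\<zero>\<index>\<close>)
  hadd :: "'a \<Rightarrow> 'a \<Rightarrow> 'a set"  (infixl \<open>\<oplus>\<index>\<close> 65)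

definition set_hadd :: "('a, 'm) hyperring_scheme \<Rightarrow> 'a set \<Rightarrow> 'a set \<Rightarrow> 'a set"
    (infixl \<open>\<boxplus>\<index>\<close> 65)
  where "A \<boxplus>\<^bsub>R\<^esub> B = (\<Union>a\<in>A. \<Union>b\<in>B. a \<oplus>\<^bsub>R\<^esub> b)"

definition hminus :: "('a, 'm) hyperring_scheme \<Rightarrow> 'a \<Rightarrow> 'a"  (\<open>(\<open>open_block notation=\<open>prefix hminus\<close>\<close>\<ominus>\<index> _)\<close> [81] 80)
  where "\<ominus>\<^bsub>R\<^esub> x = (THE y. y \<in> carrier R \<and> \<zero>\<^bsub>R\<^esub> \<in> x \<oplus>\<^bsub>R\<^esub> y)"

locale canonical_hypergroup =
  fixes R :: "('a, 'm) hyperring_scheme" (structure)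
  assumes hadd_closed: "\<lbrakk>x \<in> carrier R; y \<in> carrier R\<rbrakk> \<Longrightarrow> x \<oplus> y \<subseteq> carrier R"
    and hadd_nonempty: "\<lbrakk>x \<in> carrier R; y \<in> carrier R\<rbrakk> \<Longrightarrow> x \<oplus> y \<noteq> {}"
    and hadd_assoc: "\<lbrakk>x \<in> carrier R; y \<in> carrier R; z \<in> carrier R\<rbrakk>
      \<Longrightarrow> (x \<oplus> y) \<boxplus> {z} = {x} \<boxplus> (y \<oplus> z)"
    and hadd_comm: "\<lbrakk>x \<in> carrier R; y \<in> carrier R\<rbrakk> \<Longrightarrow> x \<oplus> y = y \<oplus> x"
    and hzero_closed: "\<zero> \<in> carrier R"
    and hzero_hadd: "x \<in> carrier R \<Longrightarrow> \<zero> \<oplus> x = {x}"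
    and ex1_opposite: "x \<in> carrier R \<Longrightarrow> \<exists>!y. y \<in> carrier R \<and> \<zero> \<in> x \<oplus> y"
    and reversible: "\<lbrakk>x \<in> carrier R; y \<in> carrier R; z \<in> x \<oplus> y\<rbrakk>
      \<Longrightarrow> y \<in> (\<ominus> x) \<oplus> z \<and> x \<in> z \<oplus> (\<ominus> y)"

text \<open>Hyperrings are commutative with unit throughout, so one-sided absorption and distributivity
  suffice.\<close>

locale krasner_hyperring = canonical_hypergroup R + comm_monoid R
  for R :: "('a, 'm) hyperring_scheme" (structure) +
  assumes mult_hzero: "x \<in> carrier R \<Longrightarrow> x \<otimes> \<zero> = \<zero>"
    and hdistrib: "\<lbrakk>x \<in> carrier R; y \<in> carrier R; z \<in> carrier R\<rbrakk>
      \<Longrightarrow> (\<otimes>) x ` (y \<oplus> z) = (x \<otimes> y) \<oplus> (x \<otimes> z)"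

locale krasner_hyperdomain = krasner_hyperring R
  for R :: "('a, 'm) hyperring_scheme" (structure) +
  assumes integral: "\<lbrakk>x \<in> carrier R; y \<in> carrier R; x \<otimes> y = \<zero>\<rbrakk> \<Longrightarrow> x = \<zero> \<or> y = \<zero>"

text \<open>The neutral \<open>{\<zero>}\<close> at the end of a nonempty list does not affect the sum.\<close>

primrec hsum_list :: "('a, 'm) hyperring_scheme \<Rightarrow> 'a list \<Rightarrow> 'a set" where
  "hsum_list R [] = {\<zero>\<^bsub>R\<^esub>}"
| "hsum_list R (x # xs) = {x} \<boxplus>\<^bsub>R\<^esub> hsum_list R xs"

section \<open>Hyperideals and integral closure\<close>

definition hyperideal :: "'a set \<Rightarrow> ('a, 'm) hyperring_scheme \<Rightarrow> bool" where
  "hyperideal I R \<longleftrightarrow> I \<subseteq> carrier R \<and> I \<noteq> {} \<and>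
     (\<forall>a\<in>I. \<forall>b\<in>I. a \<oplus>\<^bsub>R\<^esub> (\<ominus>\<^bsub>R\<^esub> b) \<subseteq> I) \<and>
     (\<forall>a\<in>I. \<forall>r\<in>carrier R. a \<otimes>\<^bsub>R\<^esub> r \<in> I)"

definition hprod :: "('a, 'm) hyperring_scheme \<Rightarrow> 'a set \<Rightarrow> 'a set \<Rightarrow> 'a set" where
  "hprod R A B = {z. \<exists>n\<ge>1. \<exists>a b. (\<forall>i\<in>{1..n}. a i \<in> A \<and> b i \<in> B) \<and>
     z \<in> hsum_list R (map (\<lambda>i. a i \<otimes>\<^bsub>R\<^esub> b i) [1..<Suc n])}"

text \<open>The value at \<open>0\<close> is a convention; the integral closure uses only exponents \<open>i \<ge> 1\<close>.\<close>

fun hpower :: "('a, 'm) hyperring_scheme \<Rightarrow> 'a set \<Rightarrow> nat \<Rightarrow> 'a set" where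
  "hpower R I 0 = carrier R"
| "hpower R I (Suc 0) = I"
| "hpower R I (Suc (Suc n)) = hprod R (hpower R I (Suc n)) I"

definition integral_closure :: "('a, 'm) hyperring_scheme \<Rightarrow> 'a set \<Rightarrow> 'a set" where
  "integral_closure R I = {r \<in> carrier R. \<exists>n\<ge>1. \<exists>a. (\<forall>i\<in>{1..n}. a i \<in> hpower R I i) \<and>
     \<zero>\<^bsub>R\<^esub> \<in> hsum_list R
       (r [^]\<^bsub>R\<^esub> n # map (\<lambda>i. a i \<otimes>\<^bsub>R\<^esub> r [^]\<^bsub>R\<^esub> (n - i)) [1..<Suc n])}"

section \<open>The quotient hyperfield\<close>

definition frac_rel :: "('a, 'm) hyperring_scheme \<Rightarrow> (('a \<times> 'a) \<times> ('a \<times> 'a)) set" where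
  "frac_rel R = {((a, b), (c, d)). a \<in> carrier R \<and> b \<in> carrier R - {\<zero>\<^bsub>R\<^esub>} \<and>
     c \<in> carrier R \<and> d \<in> carrier R - {\<zero>\<^bsub>R\<^esub>} \<and> a \<otimes>\<^bsub>R\<^esub> d = b \<otimes>\<^bsub>R\<^esub> c}"

definition frac :: "('a, 'm) hyperring_scheme \<Rightarrow> 'a \<Rightarrow> 'a \<Rightarrow> ('a \<times> 'a) set" where
  "frac R a b = frac_rel R `` {(a, b)}"

text \<open>Both operations are written as a union over all representatives; by
  \<open>quot_mult_frac\<close> and \<open>quot_hadd_frac\<close> below, the result does not depend on their choice.\<close>

definition quot_hyperfield :: "('a, 'm) hyperring_scheme \<Rightarrow> ('a \<times> 'a) set hyperring" where
  "quot_hyperfield R =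
    \<lparr> carrier = (carrier R \<times> (carrier R - {\<zero>\<^bsub>R\<^esub>})) // frac_rel R,
      mult = (\<lambda>X Y. the_elem (\<Union>(a, b)\<in>X. \<Union>(c, d)\<in>Y. {frac R (a \<otimes>\<^bsub>R\<^esub> c) (b \<otimes>\<^bsub>R\<^esub> d)})),
      one = frac R \<one>\<^bsub>R\<^esub> \<one>\<^bsub>R\<^esub>,
      hzero = frac R \<zero>\<^bsub>R\<^esub> \<one>\<^bsub>R\<^esub>,
      hadd = (\<lambda>X Y. \<Union>(a, b)\<in>X. \<Union>(c, d)\<in>Y.
        (\<lambda>x. frac R x (b \<otimes>\<^bsub>R\<^esub> d)) ` ((a \<otimes>\<^bsub>R\<^esub> d) \<oplus>\<^bsub>R\<^esub> (b \<otimes>\<^bsub>R\<^esub> c))) \<rparr>"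

definition quot_embed :: "('a, 'm) hyperring_scheme \<Rightarrow> 'a \<Rightarrow> ('a \<times> 'a) set" where
  "quot_embed R r = frac R r \<one>\<^bsub>R\<^esub>"

context krasner_hyperdomain
begin

lemma mult_cancel_left:
  assumes "a \<in> carrier R" "a \<noteq> \<zero>" "x \<in> carrier R" "y \<in> carrier R" "a \<otimes> x = a \<otimes> y"
  shows "x = y"
proof -
  obtain m where m: "m \<in> carrier R" "\<zero> \<in> y \<oplus> m"
    and uniq: "\<And>z. z \<in> carrier R \<Longrightarrow> \<zero> \<in> m \<oplus> z \<Longrightarrow> z = y"
    using ex1_opposite assms(4) hadd_comm by metis
  have "a \<otimes> \<zero> \<in> (\<otimes>) a ` (y \<oplus> m)" using m by blast
  then have "\<zero> \<in> (a \<otimes> y) \<oplus> (a \<otimes> m)" using hdistrib mult_hzero m assms by auto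
  then have "\<zero> \<in> (\<otimes>) a ` (x \<oplus> m)" using hdistrib m assms by auto
  then obtain w where w: "w \<in> x \<oplus> m" "a \<otimes> w = \<zero>" by auto
  then have "w = \<zero>" using integral assms hadd_closed m by blast
  then show ?thesis using w uniq hadd_comm m assms by metis
qed

lemma equiv_frac_rel: "equiv (carrier R \<times> (carrier R - {\<zero>})) (frac_rel R)"
proof (rule equivI)
  show "frac_rel R \<subseteq> (carrier R \<times> (carrier R - {\<zero>})) \<times> carrier R \<times> (carrier R - {\<zero>})"
    by (auto simp: frac_rel_def)
  show "refl_on (carrier R \<times> (carrier R - {\<zero>})) (frac_rel R)"
    by (auto simp: refl_on_def frac_rel_def m_comm)
  show "sym (frac_rel R)"
    by (auto simp: sym_def frac_rel_def m_comm)
  show "trans (frac_rel R)"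
  proof (rule transI, clarsimp simp: frac_rel_def)
    fix a b c d e f
    assume c: "a \<in> carrier R" "b \<in> carrier R" "c \<in> carrier R" "d \<in> carrier R" "e \<in> carrier R"
      "f \<in> carrier R" "d \<noteq> \<zero>" and 1: "a \<otimes> d = b \<otimes> c" and 2: "c \<otimes> f = d \<otimes> e"
    have "d \<otimes> (a \<otimes> f) = (a \<otimes> d) \<otimes> f" using c by (simp add: m_ac)
    also have "\<dots> = b \<otimes> (c \<otimes> f)" using c by (simp add: 1 m_assoc)
    also have "\<dots> = d \<otimes> (b \<otimes> e)" unfolding 2 using c by (simp add: m_ac)
    finally show "a \<otimes> f = b \<otimes> e" using c mult_cancel_left[of d "a \<otimes> f" "b \<otimes> e"] by simp
  qed
qed

lemma frac_eq_iff:
  assumes "a \<in> carrier R" "b \<in> carrier R - {\<zero>}" "c \<in> carrier R" "d \<in> carrier R - {\<zero>}"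
  shows "frac R a b = frac R c d \<longleftrightarrow> a \<otimes> d = b \<otimes> c"
proof -
  have "frac R a b = frac R c d \<longleftrightarrow> ((a, b), (c, d)) \<in> frac_rel R"
    unfolding frac_def by (rule eq_equiv_class_iff[OF equiv_frac_rel]) (use assms in auto)
  then show ?thesis using assms by (simp add: frac_rel_def)
qed

lemma mem_frac_iff:
  assumes "a \<in> carrier R" "b \<in> carrier R - {\<zero>}"
  shows "(c, d) \<in> frac R a b \<longleftrightarrow>
    c \<in> carrier R \<and> d \<in> carrier R - {\<zero>} \<and> a \<otimes> d = b \<otimes> c"
  using assms by (auto simp: frac_def frac_rel_def)

lemma quot_mult_frac:
  assumes "a \<in> carrier R" "b \<in> carrier R - {\<zero>}" "c \<in> carrier R" "d \<in> carrier R - {\<zero>}"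
  shows "frac R a b \<otimes>\<^bsub>quot_hyperfield R\<^esub> frac R c d = frac R (a \<otimes> c) (b \<otimes> d)"
proof -
  have *: "frac R (a' \<otimes> c') (b' \<otimes> d') = frac R (a \<otimes> c) (b \<otimes> d)"
    if ab: "(a', b') \<in> frac R a b" and cd: "(c', d') \<in> frac R c d" for a' b' c' d'
  proof -
    have c: "a' \<in> carrier R" "b' \<in> carrier R - {\<zero>}" "c' \<in> carrier R" "d' \<in> carrier R - {\<zero>}"
      and e: "a \<otimes> b' = b \<otimes> a'" "c \<otimes> d' = d \<otimes> c'"
      using ab cd assms by (auto simp: mem_frac_iff)
    have "(a \<otimes> c) \<otimes> (b' \<otimes> d') = (a \<otimes> b') \<otimes> (c \<otimes> d')" using c assms by (simp add: m_ac)
    also have "\<dots> = (b \<otimes> d) \<otimes> (a' \<otimes> c')" unfolding e using c assms by (simp add: m_ac)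
    finally have "frac R (a \<otimes> c) (b \<otimes> d) = frac R (a' \<otimes> c') (b' \<otimes> d')"
      using c assms integral by (subst frac_eq_iff) auto
    then show ?thesis by simp
  qed
  have "(a, b) \<in> frac R a b" "(c, d) \<in> frac R c d"
    using assms by (auto simp: mem_frac_iff m_comm)
  then have "(\<Union>(a', b')\<in>frac R a b. \<Union>(c', d')\<in>frac R c d. {frac R (a' \<otimes> c') (b' \<otimes> d')})
    = {frac R (a \<otimes> c) (b \<otimes> d)}"
    using * by blast
  then show ?thesis by (simp add: quot_hyperfield_def)
qed

lemma quot_hadd_frac:
  assumes "a \<in> carrier R" "b \<in> carrier R - {\<zero>}" "c \<in> carrier R" "d \<in> carrier R - {\<zero>}"
  shows "frac R a b \<oplus>\<^bsub>quot_hyperfield R\<^esub> frac R c d =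
    (\<lambda>x. frac R x (b \<otimes> d)) ` ((a \<otimes> d) \<oplus> (b \<otimes> c))"
proof -
  have *: "(\<lambda>x. frac R x (b' \<otimes> d')) ` ((a' \<otimes> d') \<oplus> (b' \<otimes> c')) \<subseteq>
      (\<lambda>x. frac R x (b \<otimes> d)) ` ((a \<otimes> d) \<oplus> (b \<otimes> c))"
    if ab: "(a', b') \<in> frac R a b" and cd: "(c', d') \<in> frac R c d" for a' b' c' d'
  proof
    have c: "a' \<in> carrier R" "b' \<in> carrier R" "b' \<noteq> \<zero>" "c' \<in> carrier R" "d' \<in> carrier R" "d' \<noteq> \<zero>"
      and e: "a \<otimes> b' = b \<otimes> a'" "c \<otimes> d' = d \<otimes> c'"
      using ab cd assms by (auto simp: mem_frac_iff)
    have e1: "(b \<otimes> d) \<otimes> (a' \<otimes> d') = (b' \<otimes> d') \<otimes> (a \<otimes> d)"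
    proof -
      have "(b \<otimes> d) \<otimes> (a' \<otimes> d') = (b \<otimes> a') \<otimes> (d \<otimes> d')" using c assms by (simp add: m_ac)
      then show ?thesis unfolding e(1)[symmetric] using c assms by (simp add: m_ac)
    qed
    have e2: "(b \<otimes> d) \<otimes> (b' \<otimes> c') = (b' \<otimes> d') \<otimes> (b \<otimes> c)"
    proof -
      have "(b \<otimes> d) \<otimes> (b' \<otimes> c') = (b \<otimes> b') \<otimes> (d \<otimes> c')" using c assms by (simp add: m_ac)
      then show ?thesis unfolding e(2)[symmetric] using c assms by (simp add: m_ac)
    qed
    fix Z assume "Z \<in> (\<lambda>x. frac R x (b' \<otimes> d')) ` ((a' \<otimes> d') \<oplus> (b' \<otimes> c'))"
    then obtain x where x: "x \<in> (a' \<otimes> d') \<oplus> (b' \<otimes> c')" "Z = frac R x (b' \<otimes> d')" by blast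
    have "(b \<otimes> d) \<otimes> x \<in> (\<otimes>) (b \<otimes> d) ` ((a' \<otimes> d') \<oplus> (b' \<otimes> c'))" using x by blast
    also have "\<dots> = (\<otimes>) (b' \<otimes> d') ` ((a \<otimes> d) \<oplus> (b \<otimes> c))"
      using c assms e1 e2 by (simp add: hdistrib)
    finally obtain y where y: "y \<in> (a \<otimes> d) \<oplus> (b \<otimes> c)"
      "(b \<otimes> d) \<otimes> x = (b' \<otimes> d') \<otimes> y" by blast
    have xy: "x \<in> carrier R" "y \<in> carrier R"
      using x(1) y(1) c assms hadd_closed[of "a' \<otimes> d'" "b' \<otimes> c'"]
        hadd_closed[of "a \<otimes> d" "b \<otimes> c"] by auto
    have nz: "b \<otimes> d \<in> carrier R - {\<zero>}" "b' \<otimes> d' \<in> carrier R - {\<zero>}"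
      using c assms integral by auto
    have "frac R x (b' \<otimes> d') = frac R y (b \<otimes> d)"
      using xy nz y(2) by (simp add: frac_eq_iff m_comm)
    then show "Z \<in> (\<lambda>x. frac R x (b \<otimes> d)) ` ((a \<otimes> d) \<oplus> (b \<otimes> c))" using x y by blast
  qed
  have mem: "(a, b) \<in> frac R a b" "(c, d) \<in> frac R c d"
    using assms by (auto simp: mem_frac_iff m_comm)
  have "(\<Union>(a', b')\<in>frac R a b. \<Union>(c', d')\<in>frac R c d.
      (\<lambda>x. frac R x (b' \<otimes> d')) ` ((a' \<otimes> d') \<oplus> (b' \<otimes> c'))) =
    (\<lambda>x. frac R x (b \<otimes> d)) ` ((a \<otimes> d) \<oplus> (b \<otimes> c))" (is "?L = ?S")
  proof
    show "?L \<subseteq> ?S"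
    proof
      fix Z assume "Z \<in> ?L"
      then obtain a' b' c' d' where "(a', b') \<in> frac R a b" "(c', d') \<in> frac R c d"
        "Z \<in> (\<lambda>x. frac R x (b' \<otimes> d')) ` ((a' \<otimes> d') \<oplus> (b' \<otimes> c'))"
        by (simp only: UN_iff Bex_def split_paired_Ex prod.case) (elim exE conjE, rule that)
      then show "Z \<in> ?S" by (rule subsetD[OF *])
    qed
    show "?S \<subseteq> ?L"
      by (rule subsetI, rule UN_I[OF mem(1)], simp only: prod.case, rule UN_I[OF mem(2)],
          simp only: prod.case)
  qed
  then show ?thesis by (simp add: quot_hyperfield_def)
qed

end

section \<open>Hypervaluation hyperdomains\<close>

definition subhyperring :: "'a set \<Rightarrow> ('a, 'm) hyperring_scheme \<Rightarrow> bool" where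
  "subhyperring S R \<longleftrightarrow> S \<subseteq> carrier R \<and> \<one>\<^bsub>R\<^esub> \<in> S \<and>
     (\<forall>a\<in>S. \<forall>b\<in>S. a \<oplus>\<^bsub>R\<^esub> (\<ominus>\<^bsub>R\<^esub> b) \<subseteq> S) \<and>
     (\<forall>a\<in>S. \<forall>b\<in>S. a \<otimes>\<^bsub>R\<^esub> b \<in> S)"

definition hypervaluation_hyperdomain :: "'a set \<Rightarrow> ('a, 'm) hyperring_scheme \<Rightarrow> bool" where
  "hypervaluation_hyperdomain V Q \<longleftrightarrow> subhyperring V Q \<and>
     (\<forall>a \<in> carrier Q - {\<zero>\<^bsub>Q\<^esub>}. a \<in> V \<or> inv\<^bsub>Q\<^esub> a \<in> V)"

definition hypervaluations :: "('a, 'm) hyperring_scheme \<Rightarrow> ('a \<times> 'a) set set set" where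
  "hypervaluations R = {V. hypervaluation_hyperdomain V (quot_hyperfield R) \<and>
     quot_embed R ` carrier R \<subseteq> V}"

definition hyperideal_extension ::
    "('a, 'm) hyperring_scheme \<Rightarrow> 'a set \<Rightarrow> ('a \<times> 'a) set set \<Rightarrow> ('a \<times> 'a) set set" where
  "hyperideal_extension R I V = hprod (quot_hyperfield R) (quot_embed R ` I) V"

text \<open>This is \<open>W \<inter> R\<close>, with \<open>R\<close> regarded as a subset of its quotient hyperfield via
  \<open>quot_embed\<close>. An intersection of such sets over \<open>hypervaluations R\<close> has to be taken inside
  \<open>carrier R\<close>: the index set is empty for the zero hyperring, which has no fractions.\<close>

definition hypercontraction ::
    "('a, 'm) hyperring_scheme \<Rightarrow> ('a \<times> 'a) set set \<Rightarrow> 'a set" where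
  "hypercontraction R W = {r \<in> carrier R. quot_embed R r \<in> W}"

end

theory Submission
  imports Defs
begin

text \<open>Let \<open>Q\<close> be the hyperfield of fractions and \<open>r \<noteq> \<zero>\<close> an element of \<open>R\<close>. The two inclusions are
  proved by contradiction, through the condition that \<open>a / r\<close> is a nonunit of \<open>V\<close> for every
  \<open>a \<in> I\<close>.

  Suppose that \<open>r\<close> satisfies an equation of integral dependence, but that \<open>r \<notin> IV\<close> for some
  hypervaluation hyperdomain \<open>V\<close>. No \<open>r / a\<close> with nonzero \<open>a \<in> I\<close> lies in \<open>V\<close>, so every \<open>a / r\<close> is a
  nonunit of \<open>V\<close>. The nonunits of \<open>V\<close> form a hyperideal of \<open>V\<close>
  (\<open>hsubgroup_nonunits\<close>, \<open>mult_nonunits\<close>), because of any two nonzero elements one divides the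
  other. It follows that \<open>b / r\<^sup>i\<close> is a nonunit for all \<open>b \<in> I\<^sup>i\<close>, \<open>i \<ge> 1\<close>, and dividing the equation by
  \<open>r\<^sup>n\<close> shows that \<open>\<one>\<close> is a nonunit, which is absurd (\<open>integral_closure_subset_extension\<close>).

  Conversely, let \<open>M0\<close> be the set of all elements of sums of elements \<open>b / r\<^sup>i\<close> with \<open>b \<in> I\<^sup>i\<close>,
  \<open>i \<ge> 1\<close>. It is closed under subtraction, multiplication, and multiplication by \<open>R\<close>, and \<open>\<one> \<in> M0\<close>
  would be an equation of integral dependence for \<open>r\<close> (\<open>integral_closureI\<close>). If \<open>r\<close> is not integral
  over \<open>I\<close>, Zorn's lemma yields a maximal \<open>M\<close> containing \<open>M0\<close> with these closure properties and
  \<open>\<one> \<notin> M\<close>. Then \<open>V = {x \<in> Q. xM \<subseteq> M}\<close> is a hypervaluation hyperdomain containing \<open>R\<close>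
  (\<open>hypervaluation_multiplier\<close>). Indeed, if \<open>x \<notin> V\<close>, maximality forces \<open>\<one>\<close> to be a combination of
  powers of \<open>x\<close> with coefficients in \<open>M\<close> (\<open>one_mem_poly_values\<close>); if also \<open>x\<^sup>-\<^sup>1 \<notin> V\<close>, there is such a
  relation for \<open>x\<^sup>-\<^sup>1\<close>, and the two relations can be played against each other to shorten one of
  them over and over, which is absurd (\<open>shorten_relation\<close>). Finally \<open>r \<in> IV\<close> would give
  \<open>\<one> = r / r \<in> (I / r)V \<subseteq> MV \<subseteq> M\<close>.

  Multiplication by a single element distributes over hypersums, but a product of two hypersums is
  merely contained in the hypersum of the products. Closure of subsets under multiplication is
  therefore always proved one factor at a time.\<close>

section \<open>Sums of subsets of a canonical hypergroup\<close>

text \<open>Subhypergroups of the additive hypergroup. Nonemptiness and closure under differences imply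
  that they contain \<open>\<zero>\<close> and are closed under opposites and sums.\<close>

definition hsubgroup :: "'a set \<Rightarrow> ('a, 'm) hyperring_scheme \<Rightarrow> bool" where
  "hsubgroup A R \<longleftrightarrow> A \<subseteq> carrier R \<and> A \<noteq> {} \<and> (\<forall>a\<in>A. \<forall>b\<in>A. a \<oplus>\<^bsub>R\<^esub> (\<ominus>\<^bsub>R\<^esub> b) \<subseteq> A)"

context canonical_hypergroup
begin

lemma set_hadd_iff: "z \<in> A \<boxplus> B \<longleftrightarrow> (\<exists>a\<in>A. \<exists>b\<in>B. z \<in> a \<oplus> b)"
  by (auto simp: set_hadd_def)

lemma set_hadd_singleton [simp]: "{x} \<boxplus> {y} = x \<oplus> y"
  by (simp add: set_hadd_def)

lemma set_hadd_mono: "A \<subseteq> A' \<Longrightarrow> B \<subseteq> B' \<Longrightarrow> A \<boxplus> B \<subseteq> A' \<boxplus> B'"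
  by (fastforce simp: set_hadd_iff)

lemma set_hadd_closed:
  "A \<subseteq> carrier R \<Longrightarrow> B \<subseteq> carrier R \<Longrightarrow> A \<boxplus> B \<subseteq> carrier R"
  using hadd_closed by (fastforce simp: set_hadd_def)

lemma set_hadd_comm:
  assumes "A \<subseteq> carrier R" "B \<subseteq> carrier R"
  shows "A \<boxplus> B = B \<boxplus> A"
  using assms hadd_comm by (fastforce simp: set_hadd_def)

lemma set_hadd_assoc:
  assumes "A \<subseteq> carrier R" "B \<subseteq> carrier R" "C \<subseteq> carrier R"
  shows "A \<boxplus> B \<boxplus> C = A \<boxplus> (B \<boxplus> C)"
proof -
  have "A \<boxplus> B \<boxplus> C = (\<Union>a\<in>A. \<Union>b\<in>B. \<Union>c\<in>C. (a \<oplus> b) \<boxplus> {c})"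
    by (auto simp: set_hadd_def)
  also have "\<dots> = (\<Union>a\<in>A. \<Union>b\<in>B. \<Union>c\<in>C. {a} \<boxplus> (b \<oplus> c))"
    using assms by (intro SUP_cong refl hadd_assoc) auto
  also have "\<dots> = A \<boxplus> (B \<boxplus> C)"
    by (auto simp: set_hadd_def)
  finally show ?thesis .
qed

lemma set_hadd_left_comm:
  assumes "A \<subseteq> carrier R" "B \<subseteq> carrier R" "C \<subseteq> carrier R"
  shows "A \<boxplus> (B \<boxplus> C) = B \<boxplus> (A \<boxplus> C)"
  using assms by (metis set_hadd_assoc set_hadd_comm)

lemma zero_set_hadd: "A \<subseteq> carrier R \<Longrightarrow> {\<zero>} \<boxplus> A = A"
  using hzero_hadd by (fastforce simp: set_hadd_def)

lemma set_hadd_zero: "A \<subseteq> carrier R \<Longrightarrow> A \<boxplus> {\<zero>} = A"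
  using set_hadd_comm[of A "{\<zero>}"] zero_set_hadd hzero_closed by auto

lemma hadd_hzero: "x \<in> carrier R \<Longrightarrow> x \<oplus> \<zero> = {x}"
  using hzero_hadd hadd_comm hzero_closed by metis

lemma hminus_props:
  assumes "x \<in> carrier R"
  shows hminus_closed [simp]: "\<ominus> x \<in> carrier R" and hadd_hminus: "\<zero> \<in> x \<oplus> (\<ominus> x)"
  using theI'[OF ex1_opposite[OF assms]] by (auto simp: hminus_def)

lemma hminus_unique:
  "x \<in> carrier R \<Longrightarrow> y \<in> carrier R \<Longrightarrow> \<zero> \<in> x \<oplus> y \<Longrightarrow> \<ominus> x = y"
  using ex1_opposite hminus_closed hadd_hminus by metis

lemma hminus_hminus [simp]: "x \<in> carrier R \<Longrightarrow> \<ominus> (\<ominus> x) = x"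
  using hminus_unique hadd_hminus hadd_comm hminus_closed by metis

lemma hminus_hzero: "\<ominus> \<zero> = \<zero>"
  using hminus_unique[of \<zero> \<zero>] hzero_hadd hzero_closed by simp

lemma hminus_mem_hadd:
  assumes "x \<in> carrier R" "y \<in> carrier R" "z \<in> x \<oplus> y"
  shows "\<ominus> z \<in> (\<ominus> x) \<oplus> (\<ominus> y)"
proof -
  have z: "z \<in> carrier R" using assms hadd_closed by blast
  have "y \<in> (\<ominus> x) \<oplus> z" using reversible assms by blast
  then have "\<ominus> x \<in> y \<oplus> (\<ominus> z)" using reversible[of "\<ominus> x" z y] assms z by auto
  then have "\<ominus> z \<in> (\<ominus> y) \<oplus> (\<ominus> x)" using reversible[of y "\<ominus> z" "\<ominus> x"] assms z by auto
  then show ?thesis using hadd_comm assms by auto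
qed

lemma hsum_list_closed: "set xs \<subseteq> carrier R \<Longrightarrow> hsum_list R xs \<subseteq> carrier R"
proof (induction xs)
  case (Cons x xs)
  then have "{x} \<boxplus> hsum_list R xs \<subseteq> carrier R" by (intro set_hadd_closed) auto
  then show ?case by simp
qed (simp add: hzero_closed)

lemma hsum_list_append:
  "set xs \<subseteq> carrier R \<Longrightarrow> set ys \<subseteq> carrier R \<Longrightarrow>
    hsum_list R (xs @ ys) = hsum_list R xs \<boxplus> hsum_list R ys"
  by (induction xs) (simp_all add: zero_set_hadd hsum_list_closed set_hadd_assoc)

lemma hsum_list_single: "x \<in> carrier R \<Longrightarrow> hsum_list R [x] = {x}"
  by (simp add: hadd_hzero)

lemma hsubgroupI:
  assumes "A \<subseteq> carrier R" "\<zero> \<in> A" "\<And>a b. a \<in> A \<Longrightarrow> b \<in> A \<Longrightarrow> a \<oplus> b \<subseteq> A"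
    "\<And>a. a \<in> A \<Longrightarrow> \<ominus> a \<in> A"
  shows "hsubgroup A R"
  using assms unfolding hsubgroup_def by auto

lemma hsubgroup_subset: "hsubgroup A R \<Longrightarrow> A \<subseteq> carrier R"
  by (simp add: hsubgroup_def)

lemma hsubgroup_zero: "hsubgroup A R \<Longrightarrow> \<zero> \<in> A"
  unfolding hsubgroup_def using hadd_hminus by blast

lemma hsubgroup_hminus: "hsubgroup A R \<Longrightarrow> a \<in> A \<Longrightarrow> \<ominus> a \<in> A"
  using hsubgroup_zero[of A] hzero_hadd[of "\<ominus> a"] unfolding hsubgroup_def
  by (metis hminus_closed insert_subset subsetD)

lemma hsubgroup_hadd: "hsubgroup A R \<Longrightarrow> a \<in> A \<Longrightarrow> b \<in> A \<Longrightarrow> a \<oplus> b \<subseteq> A"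
  using hsubgroup_hminus[of A b] unfolding hsubgroup_def
  by (metis hminus_hminus subsetD)

lemma hsum_list_subset: "hsubgroup A R \<Longrightarrow> set xs \<subseteq> A \<Longrightarrow> hsum_list R xs \<subseteq> A"
proof (induction xs)
  case (Cons x xs)
  then have "x \<in> A" "hsum_list R xs \<subseteq> A" by auto
  then show ?case using hsubgroup_hadd[OF Cons.prems(1), of x] by (auto simp: set_hadd_def)
qed (simp add: hsubgroup_zero)

lemma hsubgroup_set_hadd:
  assumes A: "hsubgroup A R" and B: "hsubgroup B R"
  shows "hsubgroup (A \<boxplus> B) R"
proof (rule hsubgroupI)
  note c = hsubgroup_subset[OF A] hsubgroup_subset[OF B]
  show "A \<boxplus> B \<subseteq> carrier R" using set_hadd_closed c .
  have "\<zero> \<in> \<zero> \<oplus> \<zero>" by (simp add: hzero_hadd hzero_closed)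
  then show "\<zero> \<in> A \<boxplus> B" using A B hsubgroup_zero by (auto simp: set_hadd_iff)
  show "x \<oplus> y \<subseteq> A \<boxplus> B" if "x \<in> A \<boxplus> B" "y \<in> A \<boxplus> B" for x y
  proof -
    have "x \<oplus> y = {x} \<boxplus> {y}" by simp
    also have "\<dots> \<subseteq> (A \<boxplus> B) \<boxplus> (A \<boxplus> B)" using that by (intro set_hadd_mono) auto
    also have "\<dots> = (A \<boxplus> A) \<boxplus> (B \<boxplus> B)"
      using c by (simp add: set_hadd_closed set_hadd_assoc set_hadd_left_comm[of B])
    also have "\<dots> \<subseteq> A \<boxplus> B"
      unfolding set_hadd_def[of R A A] set_hadd_def[of R B B]
      by (intro set_hadd_mono UN_least hsubgroup_hadd[OF A] hsubgroup_hadd[OF B])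
    finally show ?thesis .
  qed
  show "\<ominus> x \<in> A \<boxplus> B" if "x \<in> A \<boxplus> B" for x
    using that hminus_mem_hadd hsubgroup_hminus[OF A] hsubgroup_hminus[OF B] c
    unfolding set_hadd_iff by blast
qed

lemma hsubgroup_subset_set_hadd:
  assumes "hsubgroup A R" "hsubgroup B R"
  shows "A \<subseteq> A \<boxplus> B" "B \<subseteq> A \<boxplus> B"
  using set_hadd_mono[of A A "{\<zero>}" B] set_hadd_mono[of "{\<zero>}" A B B] assms
  by (simp_all add: set_hadd_zero zero_set_hadd hsubgroup_subset hsubgroup_zero)

end

text \<open>\<open>partial_hsum R F n\<close> is the sum of the subsets \<open>F 0, \<dots>, F (n - 1)\<close>.\<close>

primrec partial_hsum :: "('a, 'm) hyperring_scheme \<Rightarrow> (nat \<Rightarrow> 'a set) \<Rightarrow> nat \<Rightarrow> 'a set" where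
  "partial_hsum R F 0 = {\<zero>\<^bsub>R\<^esub>}"
| "partial_hsum R F (Suc n) = partial_hsum R F n \<boxplus>\<^bsub>R\<^esub> F n"

context canonical_hypergroup
begin

lemma hsubgroup_partial_hsum:
  "(\<And>i. hsubgroup (F i) R) \<Longrightarrow> hsubgroup (partial_hsum R F n) R"
proof (induction n)
  case 0
  show ?case by (rule hsubgroupI) (auto simp: hzero_closed hzero_hadd hminus_hzero)
qed (simp add: hsubgroup_set_hadd)

lemma partial_hsum_mono:
  assumes "\<And>i. hsubgroup (F i) R" "m \<le> n"
  shows "partial_hsum R F m \<subseteq> partial_hsum R F n"
  using assms(2)
proof (induction n rule: dec_induct)
  case (step n)
  then show ?case
    using hsubgroup_subset_set_hadd(1)[OF hsubgroup_partial_hsum assms(1), of F n n] assms(1)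
    by auto
qed simp

lemma summand_subset_partial_hsum:
  assumes "\<And>i. hsubgroup (F i) R" "i < n"
  shows "F i \<subseteq> partial_hsum R F n"
proof -
  have "F i \<subseteq> partial_hsum R F (Suc i)"
    using hsubgroup_subset_set_hadd(2)[OF hsubgroup_partial_hsum assms(1), of F i i] assms(1)
    by simp
  also have "\<dots> \<subseteq> partial_hsum R F n" using assms by (intro partial_hsum_mono) auto
  finally show ?thesis .
qed

lemma partial_hsum_subset:
  assumes "hsubgroup A R" "\<And>i. i < n \<Longrightarrow> F i \<subseteq> A"
  shows "partial_hsum R F n \<subseteq> A"
  using assms(2)
proof (induction n)
  case (Suc n)
  then have "partial_hsum R F n \<subseteq> A" "F n \<subseteq> A" by auto
  then show ?case using hsubgroup_hadd[OF assms(1)] by (fastforce simp: set_hadd_iff)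
qed (simp add: hsubgroup_zero[OF assms(1)])

lemma partial_hsum_hsum_list:
  assumes "\<And>i. hsubgroup (F i) R" "z \<in> partial_hsum R F n"
  shows "\<exists>f. (\<forall>i<n. f i \<in> F i) \<and> z \<in> hsum_list R (map f [0..<n])"
  using assms(2)
proof (induction n arbitrary: z)
  case (Suc n)
  then obtain y w where yw: "y \<in> partial_hsum R F n" "w \<in> F n" "z \<in> y \<oplus> w"
    by (auto simp: set_hadd_iff)
  from Suc.IH[OF yw(1)] obtain f where
    f: "\<forall>i<n. f i \<in> F i" "y \<in> hsum_list R (map f [0..<n])" by blast
  define g where "g = f(n := w)"
  have g: "map g [0..<n] = map f [0..<n]" by (simp add: g_def)
  have gF: "\<forall>i<Suc n. g i \<in> F i" using f yw by (auto simp: g_def less_Suc_eq)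
  have c: "set (map f [0..<n]) \<subseteq> carrier R" "w \<in> carrier R"
    using f(1) yw(2) hsubgroup_subset[OF assms(1)] by fastforce+
  have "map g [0..<Suc n] = map f [0..<n] @ [w]" using g by (simp add: g_def)
  then have "hsum_list R (map g [0..<Suc n]) = hsum_list R (map f [0..<n]) \<boxplus> {w}"
    using hsum_list_append[OF c(1), of "[w]"] c(2) by (simp add: hadd_hzero del: upt_Suc)
  then have "z \<in> hsum_list R (map g [0..<Suc n])" using yw f by (auto simp: set_hadd_iff)
  then show ?case using gF by blast
qed auto

lemma hsubgroup_Union_partial_hsum:
  assumes F: "\<And>i. hsubgroup (F i) R"
  shows "hsubgroup (\<Union>n. partial_hsum R F n) R"
proof (rule hsubgroupI)
  note G = hsubgroup_partial_hsum[where F = F, OF F]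
  show "(\<Union>n. partial_hsum R F n) \<subseteq> carrier R" using hsubgroup_subset[OF G] by blast
  show "\<zero> \<in> (\<Union>n. partial_hsum R F n)" using hsubgroup_zero[OF G] by blast
  show "x \<oplus> y \<subseteq> (\<Union>n. partial_hsum R F n)"
    if "x \<in> (\<Union>n. partial_hsum R F n)" "y \<in> (\<Union>n. partial_hsum R F n)" for x y
  proof -
    from that obtain m n where "x \<in> partial_hsum R F m" "y \<in> partial_hsum R F n" by blast
    then have "x \<in> partial_hsum R F (max m n)" "y \<in> partial_hsum R F (max m n)"
      using partial_hsum_mono[where F = F, OF F] by (meson max.cobounded1 max.cobounded2 subsetD)+
    then show ?thesis using hsubgroup_hadd[OF G] by blast
  qed
  show "\<ominus> x \<in> (\<Union>n. partial_hsum R F n)" if "x \<in> (\<Union>n. partial_hsum R F n)" for x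
    using that hsubgroup_hminus[OF G] by blast
qed

end

section \<open>Products in a Krasner hyperring\<close>

context krasner_hyperring
begin

lemma hzero_mult: "x \<in> carrier R \<Longrightarrow> \<zero> \<otimes> x = \<zero>"
  using mult_hzero m_comm hzero_closed by simp

lemma mult_hminus:
  assumes "x \<in> carrier R" "y \<in> carrier R"
  shows "x \<otimes> (\<ominus> y) = \<ominus> (x \<otimes> y)"
proof -
  have "x \<otimes> \<zero> \<in> (\<otimes>) x ` (y \<oplus> (\<ominus> y))" using hadd_hminus assms by blast
  then have "\<zero> \<in> (x \<otimes> y) \<oplus> (x \<otimes> (\<ominus> y))" using assms by (simp add: hdistrib mult_hzero)
  then show ?thesis using hminus_unique[of "x \<otimes> y" "x \<otimes> (\<ominus> y)"] assms by simp
qed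

lemma mult_mem_hadd:
  "x \<in> carrier R \<Longrightarrow> y \<in> carrier R \<Longrightarrow> z \<in> carrier R \<Longrightarrow> w \<in> y \<oplus> z \<Longrightarrow>
    x \<otimes> w \<in> (x \<otimes> y) \<oplus> (x \<otimes> z)"
  using hdistrib by blast

lemma mult_set_hadd:
  assumes "x \<in> carrier R" "A \<subseteq> carrier R" "B \<subseteq> carrier R"
  shows "(\<otimes>) x ` (A \<boxplus> B) = ((\<otimes>) x ` A) \<boxplus> ((\<otimes>) x ` B)"
proof -
  have "(\<otimes>) x ` (A \<boxplus> B) = (\<Union>a\<in>A. \<Union>b\<in>B. (\<otimes>) x ` (a \<oplus> b))"
    by (auto simp: set_hadd_def)
  also have "\<dots> = (\<Union>a\<in>A. \<Union>b\<in>B. (x \<otimes> a) \<oplus> (x \<otimes> b))"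
    using assms by (intro SUP_cong refl hdistrib) auto
  also have "\<dots> = ((\<otimes>) x ` A) \<boxplus> ((\<otimes>) x ` B)"
    by (auto simp: set_hadd_def)
  finally show ?thesis .
qed

lemma mult_hsum_list:
  "x \<in> carrier R \<Longrightarrow> set xs \<subseteq> carrier R \<Longrightarrow>
    (\<otimes>) x ` hsum_list R xs = hsum_list R (map ((\<otimes>) x) xs)"
  by (induction xs) (simp_all add: mult_hzero mult_set_hadd hsum_list_closed)

lemma hsubgroup_mult:
  assumes x: "x \<in> carrier R" and A: "hsubgroup A R"
  shows "hsubgroup ((\<otimes>) x ` A) R"
proof (rule hsubgroupI)
  note c = hsubgroup_subset[OF A]
  show "(\<otimes>) x ` A \<subseteq> carrier R" using x c by auto
  show "\<zero> \<in> (\<otimes>) x ` A" using mult_hzero[OF x] hsubgroup_zero[OF A] by force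
  show "a \<oplus> b \<subseteq> (\<otimes>) x ` A" if "a \<in> (\<otimes>) x ` A" "b \<in> (\<otimes>) x ` A" for a b
  proof -
    from that obtain a' b' where "a = x \<otimes> a'" "b = x \<otimes> b'" "a' \<in> A" "b' \<in> A" by blast
    then show ?thesis using hsubgroup_hadd[OF A, of a' b'] hdistrib[OF x, of a' b'] c by auto
  qed
  show "\<ominus> a \<in> (\<otimes>) x ` A" if "a \<in> (\<otimes>) x ` A" for a
  proof -
    from that obtain a' where a': "a = x \<otimes> a'" "a' \<in> A" by blast
    then have "\<ominus> a = x \<otimes> (\<ominus> a')" using mult_hminus[OF x, of a'] c by auto
    then show ?thesis using hsubgroup_hminus[OF A a'(2)] by blast
  qed
qed

text \<open>An element that multiplies every summand into a subhypergroup \<open>B\<close> multiplies the whole sum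
  into \<open>B\<close>. Only distributivity for a single factor is needed.\<close>

lemma mult_partial_hsum_mem:
  assumes F: "\<And>i. hsubgroup (F i) R" and B: "hsubgroup B R" and x: "x \<in> carrier R"
    and "\<And>i y. i < n \<Longrightarrow> y \<in> F i \<Longrightarrow> x \<otimes> y \<in> B" and "z \<in> partial_hsum R F n"
  shows "x \<otimes> z \<in> B"
  using assms(4,5)
proof (induction n arbitrary: z)
  case 0
  then show ?case using x mult_hzero hsubgroup_zero[OF B] by simp
next
  case (Suc n)
  from Suc.prems(2) obtain y w where yw: "y \<in> partial_hsum R F n" "w \<in> F n" "z \<in> y \<oplus> w"
    by (auto simp: set_hadd_iff)
  have "x \<otimes> y \<in> B" using Suc.IH[OF _ yw(1)] Suc.prems(1) by (meson less_SucI)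
  moreover have "x \<otimes> w \<in> B" using Suc.prems(1) yw(2) by blast
  moreover have "x \<otimes> z \<in> (x \<otimes> y) \<oplus> (x \<otimes> w)"
    using yw x hsubgroup_subset[OF F] hsubgroup_subset[OF hsubgroup_partial_hsum[where F = F, OF F]]
    by (intro mult_mem_hadd) blast+
  ultimately show ?case using hsubgroup_hadd[OF B] by blast
qed

lemma mult_Union_partial_hsum:
  assumes F: "\<And>i. hsubgroup (F i) R" and B: "hsubgroup B R"
    and m: "\<And>i j x y. x \<in> F i \<Longrightarrow> y \<in> F j \<Longrightarrow> x \<otimes> y \<in> B"
    and x: "x \<in> (\<Union>n. partial_hsum R F n)" and y: "y \<in> (\<Union>n. partial_hsum R F n)"
  shows "x \<otimes> y \<in> B"
proof -
  have c: "x \<in> carrier R" "y \<in> carrier R"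
    using x y hsubgroup_subset[OF hsubgroup_Union_partial_hsum[where F = F, OF F]] by blast+
  have *: "y \<otimes> a \<in> B" if "a \<in> F i" for i a
  proof -
    have a: "a \<in> carrier R" using that hsubgroup_subset[OF F] by blast
    from y obtain n where "y \<in> partial_hsum R F n" by blast
    then have "a \<otimes> y \<in> B"
      using mult_partial_hsum_mem[where F = F, OF F B a] m that by metis
    then show ?thesis using m_comm a c by simp
  qed
  from x obtain n where "x \<in> partial_hsum R F n" by blast
  then have "y \<otimes> x \<in> B" using mult_partial_hsum_mem[where F = F, OF F B c(2)] * by metis
  then show ?thesis using m_comm c by simp
qed

text \<open>The product of two subsets in terms of nonempty lists of elementary products, which are easier
  to concatenate than families indexed by \<open>{1..n}\<close>.\<close>

lemma hprod_iff:
  "z \<in> hprod R A B \<longleftrightarrow>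
    (\<exists>xs. xs \<noteq> [] \<and> set xs \<subseteq> {a \<otimes> b | a b. a \<in> A \<and> b \<in> B} \<and> z \<in> hsum_list R xs)"
  (is "?L \<longleftrightarrow> ?S")
proof
  assume ?L
  then obtain n a b where n: "n \<ge> 1" and ab: "\<forall>i\<in>{1..n}. a i \<in> A \<and> b i \<in> B"
    and z: "z \<in> hsum_list R (map (\<lambda>i. a i \<otimes> b i) [1..<Suc n])"
    unfolding hprod_def by blast
  have "set (map (\<lambda>i. a i \<otimes> b i) [1..<Suc n]) \<subseteq> {a \<otimes> b | a b. a \<in> A \<and> b \<in> B}"
    using ab by fastforce
  moreover have "map (\<lambda>i. a i \<otimes> b i) [1..<Suc n] \<noteq> []" using n by simp
  ultimately show ?S using z by blast
next
  assume ?S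
  then obtain xs where xs: "xs \<noteq> []" "set xs \<subseteq> {a \<otimes> b | a b. a \<in> A \<and> b \<in> B}"
    "z \<in> hsum_list R xs" by blast
  have "\<forall>x\<in>set xs. \<exists>p. fst p \<in> A \<and> snd p \<in> B \<and> x = fst p \<otimes> snd p" using xs(2) by fastforce
  then obtain f where f: "\<forall>x\<in>set xs. fst (f x) \<in> A \<and> snd (f x) \<in> B \<and> x = fst (f x) \<otimes> snd (f x)"
    by metis
  define a b where "a = (\<lambda>i. fst (f (xs ! (i - 1))))" and "b = (\<lambda>i. snd (f (xs ! (i - 1))))"
  have e: "a i \<in> A \<and> b i \<in> B \<and> a i \<otimes> b i = xs ! (i - 1)" if "i \<in> {1..length xs}" for i
  proof -
    have "xs ! (i - 1) \<in> set xs" using that by (intro nth_mem) auto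
    then show ?thesis using f unfolding a_def b_def by metis
  qed
  have "map (\<lambda>i. a i \<otimes> b i) [1..<Suc (length xs)] = xs"
    by (rule nth_equalityI) (use e in \<open>auto simp del: upt_Suc\<close>)
  moreover have "length xs \<ge> 1" using xs(1) by (cases xs) auto
  ultimately show ?L using e xs(3) unfolding hprod_def by (intro CollectI exI[of _ "length xs"]) metis
qed

lemma hprod_mult:
  assumes "A \<subseteq> carrier R" "B \<subseteq> carrier R" "a \<in> A" "b \<in> B"
  shows "a \<otimes> b \<in> hprod R A B"
proof -
  have "a \<otimes> b \<in> hsum_list R [a \<otimes> b]"
    using assms by (subst hsum_list_single) auto
  then show ?thesis unfolding hprod_iff using assms by (intro exI[of _ "[a \<otimes> b]"]) auto
qed

lemma hprod_subset:
  assumes "hsubgroup C R" "\<And>a b. a \<in> A \<Longrightarrow> b \<in> B \<Longrightarrow> a \<otimes> b \<in> C"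
  shows "hprod R A B \<subseteq> C"
proof
  fix z assume "z \<in> hprod R A B"
  then obtain xs where "set xs \<subseteq> {a \<otimes> b | a b. a \<in> A \<and> b \<in> B}" "z \<in> hsum_list R xs"
    unfolding hprod_iff by blast
  moreover from this(1) have "set xs \<subseteq> C" using assms(2) by blast
  ultimately show "z \<in> C" using hsum_list_subset[OF assms(1)] by blast
qed

lemma mult_hprod_mem:
  assumes "hsubgroup C R" "A \<subseteq> carrier R" "B \<subseteq> carrier R" "x \<in> carrier R"
    and m: "\<And>a b. a \<in> A \<Longrightarrow> b \<in> B \<Longrightarrow> x \<otimes> (a \<otimes> b) \<in> C" and z: "z \<in> hprod R A B"
  shows "x \<otimes> z \<in> C"
proof -
  from z obtain xs where xs: "set xs \<subseteq> {a \<otimes> b | a b. a \<in> A \<and> b \<in> B}" "z \<in> hsum_list R xs"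
    unfolding hprod_iff by blast
  have "set xs \<subseteq> carrier R" using xs(1) assms by fastforce
  then have "x \<otimes> z \<in> hsum_list R (map ((\<otimes>) x) xs)"
    using mult_hsum_list[OF assms(4)] xs(2) by blast
  moreover have "set (map ((\<otimes>) x) xs) \<subseteq> C" using xs(1) m by auto
  ultimately show ?thesis using hsum_list_subset[OF assms(1)] by blast
qed

lemma hyperideal_iff:
  "hyperideal I R \<longleftrightarrow> hsubgroup I R \<and> (\<forall>a\<in>I. \<forall>r\<in>carrier R. a \<otimes> r \<in> I)"
  by (auto simp: hyperideal_def hsubgroup_def)

lemma hyperideal_carrier: "hyperideal (carrier R) R"
  unfolding hyperideal_iff
  by (intro conjI hsubgroupI) (simp_all add: hzero_closed hadd_closed)

lemma hyperideal_hprod: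
  assumes I: "hyperideal I R" and J: "hyperideal J R"
  shows "hyperideal (hprod R I J) R"
proof -
  have Is: "hsubgroup I R" "hsubgroup J R" and Jm: "\<And>a r. a \<in> J \<Longrightarrow> r \<in> carrier R \<Longrightarrow> a \<otimes> r \<in> J"
    using I J by (auto simp: hyperideal_iff)
  note c = Is[THEN hsubgroup_subset]
  let ?P = "{a \<otimes> b | a b. a \<in> I \<and> b \<in> J}"
  have P: "?P \<subseteq> carrier R" using c by auto
  have scale: "r \<otimes> z \<in> hprod R I J" if z: "z \<in> hprod R I J" and r: "r \<in> carrier R" for r z
  proof -
    from z obtain xs where xs: "xs \<noteq> []" "set xs \<subseteq> ?P" "z \<in> hsum_list R xs"
      unfolding hprod_iff by blast
    have "r \<otimes> (a \<otimes> b) \<in> ?P" if "a \<in> I" "b \<in> J" for a b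
    proof -
      have "r \<otimes> (a \<otimes> b) = a \<otimes> (b \<otimes> r)" using that r c by (simp add: m_ac subset_iff)
      then show ?thesis using that Jm r by blast
    qed
    then have "set (map ((\<otimes>) r) xs) \<subseteq> ?P" using xs(2) by auto
    moreover have "r \<otimes> z \<in> hsum_list R (map ((\<otimes>) r) xs)"
      using mult_hsum_list[OF r, of xs] xs P by blast
    ultimately show ?thesis unfolding hprod_iff using xs(1) by (intro exI[of _ "map ((\<otimes>) r) xs"]) auto
  qed
  have "hsubgroup (hprod R I J) R"
  proof (rule hsubgroupI)
    show sub: "hprod R I J \<subseteq> carrier R"
      by (rule hprod_subset) (use hyperideal_carrier c in \<open>auto simp: hyperideal_iff\<close>)
    show "\<zero> \<in> hprod R I J"
      using hprod_mult[OF c, of \<zero> \<zero>] Is hsubgroup_zero by (simp add: mult_hzero hzero_closed)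
    show "x \<oplus> y \<subseteq> hprod R I J" if "x \<in> hprod R I J" "y \<in> hprod R I J" for x y
    proof -
      from that obtain xs ys where xs: "xs \<noteq> []" "set xs \<subseteq> ?P" "x \<in> hsum_list R xs"
        and ys: "ys \<noteq> []" "set ys \<subseteq> ?P" "y \<in> hsum_list R ys"
        unfolding hprod_iff by blast
      have "x \<oplus> y \<subseteq> hsum_list R (xs @ ys)"
        using xs ys P by (subst hsum_list_append) (blast intro: set_hadd_iff[THEN iffD2])+
      moreover have "xs @ ys \<noteq> [] \<and> set (xs @ ys) \<subseteq> ?P" using xs ys by simp
      ultimately show ?thesis unfolding hprod_iff subset_iff by blast
    qed
    show "\<ominus> x \<in> hprod R I J" if "x \<in> hprod R I J" for x
    proof -
      have x: "x \<in> carrier R" using that sub by blast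
      have "(\<ominus> \<one>) \<otimes> x = \<ominus> x" using mult_hminus[of x \<one>] x by (simp add: m_comm)
      then show ?thesis using scale[OF that, of "\<ominus> \<one>"] by simp
    qed
  qed
  moreover have "z \<otimes> r \<in> hprod R I J" if "z \<in> hprod R I J" "r \<in> carrier R" for z r
    using scale[OF that] that m_comm hsubgroup_subset[OF calculation] by auto
  ultimately show ?thesis by (simp add: hyperideal_iff)
qed

lemma hyperideal_hpower: "hyperideal I R \<Longrightarrow> hyperideal (hpower R I n) R"
proof (induction n)
  case (Suc n)
  then show ?case by (cases n) (simp_all add: hyperideal_hprod)
qed (simp add: hyperideal_carrier)

end

section \<open>Hypervaluation hyperdomains of a hyperfield\<close>

locale krasner_hyperfield = krasner_hyperring R
  for R :: "('a, 'm) hyperring_scheme" (structure) +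
  assumes one_not_zero: "\<one> \<noteq> \<zero>"
    and nonzero_Units: "\<lbrakk>x \<in> carrier R; x \<noteq> \<zero>\<rbrakk> \<Longrightarrow> x \<in> Units R"

text \<open>A subset \<open>M\<close> that is closed under subtraction, multiplication, and multiplication by the elements
  of \<open>A\<close>, and does not contain \<open>\<one>\<close>. The hyperideal of nonunits of a hypervaluation hyperdomain
  containing \<open>A\<close> is of this kind.\<close>

definition nonunital_subhyperring ::
    "('a, 'm) hyperring_scheme \<Rightarrow> 'a set \<Rightarrow> 'a set \<Rightarrow> bool" where
  "nonunital_subhyperring R A M \<longleftrightarrow> hsubgroup M R \<and> \<one>\<^bsub>R\<^esub> \<notin> M \<and>
     (\<forall>x\<in>M. \<forall>y\<in>M. x \<otimes>\<^bsub>R\<^esub> y \<in> M) \<and> (\<forall>a\<in>A. \<forall>x\<in>M. a \<otimes>\<^bsub>R\<^esub> x \<in> M)"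

text \<open>The multiplier of \<open>M\<close> consists of the elements \<open>x\<close> with \<open>xM \<subseteq> M\<close>.\<close>

definition multiplier :: "('a, 'm) hyperring_scheme \<Rightarrow> 'a set \<Rightarrow> 'a set" where
  "multiplier R M = {x \<in> carrier R. \<forall>m\<in>M. x \<otimes>\<^bsub>R\<^esub> m \<in> M}"

context krasner_hyperring
begin

lemma subhyperring_iff:
  "subhyperring V R \<longleftrightarrow> hsubgroup V R \<and> \<one> \<in> V \<and> (\<forall>a\<in>V. \<forall>b\<in>V. a \<otimes> b \<in> V)"
  by (auto simp: subhyperring_def hsubgroup_def)

lemma subhyperring_multiplier:
  assumes M: "hsubgroup M R"
  shows "subhyperring (multiplier R M) R"
proof -
  note c = hsubgroup_subset[OF M]
  have "hsubgroup (multiplier R M) R"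
  proof (rule hsubgroupI)
    show "\<zero> \<in> multiplier R M"
      using hzero_mult hsubgroup_zero[OF M] c hzero_closed by (auto simp: multiplier_def)
    show "a \<oplus> b \<subseteq> multiplier R M" if "a \<in> multiplier R M" "b \<in> multiplier R M" for a b
    proof
      fix z assume z: "z \<in> a \<oplus> b"
      have ab: "a \<in> carrier R" "b \<in> carrier R" using that by (auto simp: multiplier_def)
      have zc: "z \<in> carrier R" using hadd_closed ab z by blast
      have "z \<otimes> m \<in> M" if m: "m \<in> M" for m
      proof -
        have mc: "m \<in> carrier R" using m c by blast
        have "m \<otimes> z \<in> (m \<otimes> a) \<oplus> (m \<otimes> b)" using mult_mem_hadd[OF mc ab z] .
        also have "\<dots> = (a \<otimes> m) \<oplus> (b \<otimes> m)" using ab mc by (simp add: m_comm)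
        also have "\<dots> \<subseteq> M"
          using \<open>a \<in> multiplier R M\<close> \<open>b \<in> multiplier R M\<close> m
          by (intro hsubgroup_hadd[OF M]) (auto simp: multiplier_def)
        finally show ?thesis using zc mc by (simp add: m_comm)
      qed
      then show "z \<in> multiplier R M" using zc by (simp add: multiplier_def)
    qed
    show "\<ominus> a \<in> multiplier R M" if "a \<in> multiplier R M" for a
    proof -
      have "(\<ominus> a) \<otimes> m \<in> M" if m: "m \<in> M" for m
      proof -
        have "m \<otimes> (\<ominus> a) = \<ominus> (a \<otimes> m)"
          using mult_hminus[of m a] \<open>a \<in> multiplier R M\<close> m c
          by (simp add: multiplier_def m_comm subset_iff)
        moreover have "\<ominus> (a \<otimes> m) \<in> M"
          using hsubgroup_hminus[OF M] \<open>a \<in> multiplier R M\<close> m by (simp add: multiplier_def)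
        moreover have "(\<ominus> a) \<otimes> m = m \<otimes> (\<ominus> a)"
          using \<open>a \<in> multiplier R M\<close> m c by (intro m_comm) (auto simp: multiplier_def)
        ultimately show ?thesis by simp
      qed
      then show ?thesis using that by (simp add: multiplier_def)
    qed
  qed (simp add: multiplier_def)
  moreover have "\<one> \<in> multiplier R M" using c by (auto simp: multiplier_def)
  moreover have "a \<otimes> b \<in> multiplier R M" if "a \<in> multiplier R M" "b \<in> multiplier R M" for a b
    using that c by (auto simp: multiplier_def m_assoc)
  ultimately show ?thesis by (simp add: subhyperring_iff)
qed

lemma exists_maximal_nonunital_subhyperring:
  assumes M0: "nonunital_subhyperring R A M0"
  obtains M where "nonunital_subhyperring R A M" "M0 \<subseteq> M"
    "\<And>N. nonunital_subhyperring R A N \<Longrightarrow> M \<subseteq> N \<Longrightarrow> N = M"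
proof -
  let ?S = "{N. nonunital_subhyperring R A N \<and> M0 \<subseteq> N}"
  have "\<exists>M\<in>?S. \<forall>N\<in>?S. M \<subseteq> N \<longrightarrow> N = M"
  proof (rule subset_Zorn_nonempty)
    show "?S \<noteq> {}" using M0 by blast
    fix C assume ne: "C \<noteq> {}" and ch: "subset.chain ?S C"
    have C: "\<And>N. N \<in> C \<Longrightarrow> nonunital_subhyperring R A N \<and> M0 \<subseteq> N"
      using ch by (auto simp: subset.chain_def)
    have H: "\<And>N. N \<in> C \<Longrightarrow> hsubgroup N R"
      using C by (simp add: nonunital_subhyperring_def)
    have two: "\<exists>N\<in>C. x \<in> N \<and> y \<in> N" if "x \<in> \<Union>C" "y \<in> \<Union>C" for x y
      using that ch unfolding subset.chain_def by blast
    have "hsubgroup (\<Union>C) R"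
    proof (rule hsubgroupI)
      show "\<Union>C \<subseteq> carrier R" using H hsubgroup_subset by blast
      show "\<zero> \<in> \<Union>C" using H hsubgroup_zero ne by blast
      show "a \<oplus> b \<subseteq> \<Union>C" if "a \<in> \<Union>C" "b \<in> \<Union>C" for a b
        using two[OF that] H hsubgroup_hadd by blast
      show "\<ominus> a \<in> \<Union>C" if "a \<in> \<Union>C" for a
        using that H hsubgroup_hminus by blast
    qed
    moreover have "x \<otimes> y \<in> \<Union>C" if "x \<in> \<Union>C" "y \<in> \<Union>C" for x y
      using two[OF that] C unfolding nonunital_subhyperring_def by blast
    moreover have "\<one> \<notin> \<Union>C" "\<And>a x. a \<in> A \<Longrightarrow> x \<in> \<Union>C \<Longrightarrow> a \<otimes> x \<in> \<Union>C"
      using C unfolding nonunital_subhyperring_def by blast+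
    ultimately show "\<Union>C \<in> ?S" using C ne unfolding nonunital_subhyperring_def by blast
  qed
  then obtain M where M: "nonunital_subhyperring R A M" "M0 \<subseteq> M"
    "\<forall>N\<in>?S. M \<subseteq> N \<longrightarrow> N = M" by blast
  show ?thesis by (rule that[OF M(1,2)]) (use M in blast)
qed

text \<open>All elements of the hypersums \<open>m\<^sub>0 + m\<^sub>1 x + \<dots>\<close> with \<open>n\<close> summands and coefficients in \<open>M\<close>;
  the exponents run from \<open>0\<close> to \<open>n - 1\<close>.\<close>

abbreviation poly_values :: "'a set \<Rightarrow> 'a \<Rightarrow> nat \<Rightarrow> 'a set" where
  "poly_values M x n \<equiv> partial_hsum R (\<lambda>i. (\<otimes>) (x [^] i) ` M) n"

lemma poly_values_horner:
  assumes M: "hsubgroup M R" and x: "x \<in> carrier R"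
  shows "poly_values M x (Suc n) \<subseteq> M \<boxplus> ((\<otimes>) x ` poly_values M x n)"
proof (rule partial_hsum_subset)
  note c = hsubgroup_subset[OF M]
  have F: "hsubgroup ((\<otimes>) (x [^] i) ` M) R" for i :: nat using M x by (simp add: hsubgroup_mult)
  have P: "hsubgroup ((\<otimes>) x ` poly_values M x n) R"
    using hsubgroup_mult[OF x hsubgroup_partial_hsum] F by simp
  show "hsubgroup (M \<boxplus> ((\<otimes>) x ` poly_values M x n)) R" using hsubgroup_set_hadd[OF M P] .
  fix i assume i: "i < Suc n"
  show "(\<otimes>) (x [^] i) ` M \<subseteq> M \<boxplus> ((\<otimes>) x ` poly_values M x n)"
  proof (cases i)
    case 0
    have "(\<otimes>) (x [^] i) ` M = M" using c 0 by (auto simp: image_iff subset_iff)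
    then show ?thesis using hsubgroup_subset_set_hadd(1)[OF M P] by simp
  next
    case (Suc j)
    have "x [^] i \<otimes> m = x \<otimes> (x [^] j \<otimes> m)" if "m \<in> M" for m
      using that c x Suc by (simp add: m_ac subset_iff)
    moreover have "(\<otimes>) (x [^] j) ` M \<subseteq> poly_values M x n"
      using summand_subset_partial_hsum[of "\<lambda>i. (\<otimes>) (x [^] i) ` M" j n] F Suc i by simp
    ultimately have "(\<otimes>) (x [^] i) ` M \<subseteq> (\<otimes>) x ` poly_values M x n" by auto
    then show ?thesis using hsubgroup_subset_set_hadd(2)[OF M P] by blast
  qed
qed

end

context krasner_hyperfield
begin

context
  fixes A M :: "'a set"
  assumes A: "A \<subseteq> carrier R" and M: "nonunital_subhyperring R A M"
    and max: "\<And>N. nonunital_subhyperring R A N \<Longrightarrow> M \<subseteq> N \<Longrightarrow> N = M"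
begin

lemma M_props:
  shows M_hsubgroup: "hsubgroup M R" and M_carrier: "\<And>m. m \<in> M \<Longrightarrow> m \<in> carrier R"
    and M_one: "\<one> \<notin> M" and M_mult: "\<And>x y. x \<in> M \<Longrightarrow> y \<in> M \<Longrightarrow> x \<otimes> y \<in> M"
    and M_A: "\<And>a x. a \<in> A \<Longrightarrow> x \<in> M \<Longrightarrow> a \<otimes> x \<in> M"
  using M hsubgroup_subset by (auto simp: nonunital_subhyperring_def)

lemma powers_hsubgroup:
  "x \<in> carrier R \<Longrightarrow> hsubgroup ((\<otimes>) (x [^] (i::nat)) ` M) R"
  using M_hsubgroup by (simp add: hsubgroup_mult)

lemma powers_subset_poly_values:
  "x \<in> carrier R \<Longrightarrow> i < n \<Longrightarrow> m \<in> M \<Longrightarrow> x [^] i \<otimes> m \<in> poly_values M x n"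
  using summand_subset_partial_hsum[of "\<lambda>i. (\<otimes>) (x [^] i) ` M", OF powers_hsubgroup] by blast

lemma poly_values_hsubgroup: "x \<in> carrier R \<Longrightarrow> hsubgroup (poly_values M x n) R"
  using powers_hsubgroup by (intro hsubgroup_partial_hsum)

lemma mult_poly_values_mem:
  assumes "x \<in> carrier R" "y \<in> carrier R" "hsubgroup B R"
    "\<And>i m. i < n \<Longrightarrow> m \<in> M \<Longrightarrow> y \<otimes> (x [^] i \<otimes> m) \<in> B" "z \<in> poly_values M x n"
  shows "y \<otimes> z \<in> B"
  by (rule mult_partial_hsum_mem[OF powers_hsubgroup[OF assms(1)] assms(3,2) _ assms(5)])
    (use assms(4) in auto)

lemma multiplier_mult_poly_values:
  assumes x: "x \<in> carrier R" and v: "v \<in> multiplier R M" and z: "z \<in> poly_values M x n"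
  shows "v \<otimes> z \<in> poly_values M x n"
proof (rule mult_poly_values_mem[OF x _ poly_values_hsubgroup[OF x] _ z])
  show v': "v \<in> carrier R" using v by (simp add: multiplier_def)
  fix i m assume i: "i < n" and m: "m \<in> M"
  have "v \<otimes> (x [^] i \<otimes> m) = x [^] i \<otimes> (v \<otimes> m)" using x v' m M_carrier by (simp add: m_ac)
  also have "\<dots> \<in> poly_values M x n"
    using powers_subset_poly_values[OF x i] v m by (simp add: multiplier_def)
  finally show "v \<otimes> (x [^] i \<otimes> m) \<in> poly_values M x n" .
qed

lemma A_subset_multiplier: "A \<subseteq> multiplier R M"
  using A M_A by (auto simp: multiplier_def)

lemma M_subset_multiplier: "M \<subseteq> multiplier R M"
  using M_carrier M_mult by (auto simp: multiplier_def)

text \<open>The union of the sets \<open>poly_values M x n\<close> is \<open>M[x] M\<close>. Unless \<open>x\<close> multiplies \<open>M\<close> into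
  itself, it is strictly larger than \<open>M\<close>, and hence contains the unit.\<close>

lemma one_mem_poly_values:
  assumes x: "x \<in> carrier R" and xV: "x \<notin> multiplier R M"
  shows "\<exists>n. \<one> \<in> poly_values M x n"
proof (rule ccontr)
  assume no: "\<nexists>n. \<one> \<in> poly_values M x n"
  let ?N = "\<Union>n. poly_values M x n"
  have F: "x [^] i \<otimes> m \<in> ?N" if "m \<in> M" for m and i :: nat
    using powers_subset_poly_values[OF x lessI that] by blast
  have N: "hsubgroup ?N R" by (rule hsubgroup_Union_partial_hsum) (rule powers_hsubgroup[OF x])
  have "nonunital_subhyperring R A ?N"
    unfolding nonunital_subhyperring_def
  proof (intro conjI ballI)
    show "hsubgroup ?N R" by (rule N)
    show "\<one> \<notin> ?N" using no by blast
    fix z assume z: "z \<in> ?N"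
    show "y \<otimes> z \<in> ?N" if y: "y \<in> ?N" for y
    proof (rule mult_Union_partial_hsum[OF powers_hsubgroup[OF x] N _ y z])
      fix i j a b assume "a \<in> (\<otimes>) (x [^] (i::nat)) ` M" "b \<in> (\<otimes>) (x [^] (j::nat)) ` M"
      then obtain m m' where mm: "a = x [^] i \<otimes> m" "b = x [^] j \<otimes> m'" "m \<in> M" "m' \<in> M" by blast
      have "a \<otimes> b = x [^] (i + j) \<otimes> (m \<otimes> m')"
        using x mm M_carrier by (simp add: nat_pow_mult[symmetric] m_ac)
      then show "a \<otimes> b \<in> ?N" using F M_mult mm by simp
    qed
    show "a \<otimes> z \<in> ?N" if a: "a \<in> A" for a
      using multiplier_mult_poly_values[OF x] A_subset_multiplier a z by blast
  qed
  moreover have "M \<subseteq> ?N" using F[of _ 0] M_carrier by auto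
  ultimately have "?N = M" by (rule max)
  then have "x \<otimes> m \<in> M" if "m \<in> M" for m using F[OF that, of 1] x by simp
  then show False using xV x by (simp add: multiplier_def)
qed

text \<open>Elements congruent to \<open>\<one>\<close> modulo \<open>M\<close> are units of the multiplier, as in a local ring with
  maximal ideal \<open>M\<close>.\<close>

lemma inv_one_minus_mem:
  assumes m: "m \<in> M" and u: "u \<in> \<one> \<oplus> (\<ominus> m)"
  shows "u \<in> Units R" "inv u \<in> multiplier R M"
proof -
  note V = subhyperring_multiplier[OF M_hsubgroup, unfolded subhyperring_iff]
  have uc: "u \<in> carrier R" using hadd_closed u M_carrier[OF m] by (meson hminus_closed one_closed subsetD)
  have "u \<noteq> \<zero>"
  proof
    assume "u = \<zero>"
    then have "\<ominus> \<one> = \<ominus> m" using u M_carrier[OF m] by (intro hminus_unique) auto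
    then have "\<one> = m" using M_carrier[OF m] hminus_hminus by (metis one_closed)
    then show False using m M_one by simp
  qed
  then show U: "u \<in> Units R" using nonzero_Units uc by blast
  have uV: "u \<in> multiplier R M"
  proof -
    have "\<ominus> m \<in> multiplier R M" using hsubgroup_hminus[OF M_hsubgroup m] M_subset_multiplier by blast
    then show ?thesis using hsubgroup_hadd[of "multiplier R M" \<one> "\<ominus> m"] V u by blast
  qed
  \<comment> \<open>Since \<open>u\<close> is congruent to \<open>\<one>\<close>, so are its powers, and none of them lies in \<open>M\<close>.\<close>
  have descend: "u [^] n \<in> M \<Longrightarrow> \<one> \<in> M" for n :: nat
  proof (induction n)
    case (Suc n)
    let ?p = "u [^] n"
    have pc: "?p \<in> carrier R" using uc by simp
    have pV: "?p \<in> multiplier R M" by (induction n) (use V uV in auto)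
    have "?p \<otimes> u \<in> (?p \<otimes> \<one>) \<oplus> (?p \<otimes> (\<ominus> m))"
      using mult_mem_hadd[OF pc _ _ u] M_carrier[OF m] by simp
    then have "?p \<otimes> u \<in> ?p \<oplus> (?p \<otimes> (\<ominus> m))" using pc by simp
    then have "?p \<in> (?p \<otimes> u) \<oplus> (\<ominus> (?p \<otimes> (\<ominus> m)))"
      using reversible pc M_carrier[OF m] by simp
    moreover have "\<ominus> (?p \<otimes> (\<ominus> m)) = ?p \<otimes> m" using mult_hminus[OF pc] M_carrier[OF m] pc by simp
    moreover have "?p \<otimes> m \<in> M" using pV m by (simp add: multiplier_def)
    ultimately have "?p \<in> M" using hsubgroup_hadd[OF M_hsubgroup] Suc.prems by auto
    then show ?case by (rule Suc.IH)
  qed simp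
  show "inv u \<in> multiplier R M"
  proof (rule ccontr)
    assume "inv u \<notin> multiplier R M"
    \<comment> \<open>Multiplication by \<open>u\<^sup>n\<close> turns a relation for \<open>u\<^sup>-\<^sup>1\<close> into \<open>u\<^sup>n \<in> M\<close>.\<close>
    then obtain n where n: "\<one> \<in> poly_values M (inv u) n"
      using one_mem_poly_values[of "inv u"] U by auto
    have "u [^] n \<otimes> \<one> \<in> M"
    proof (rule mult_poly_values_mem[OF _ _ M_hsubgroup _ n])
      fix i k assume i: "i < n" and k: "k \<in> M"
      have 1: "u [^] i \<otimes> inv u [^] i = \<one>"
        using U uc by (simp add: nat_pow_distrib[symmetric] Units_r_inv)
      have "u [^] n \<otimes> (inv u [^] i \<otimes> k) = u [^] (n - i) \<otimes> (u [^] i \<otimes> inv u [^] i) \<otimes> k"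
        using U uc k M_carrier i nat_pow_mult[OF uc, of "n - i" i] by (simp add: m_assoc[symmetric])
      also have "\<dots> = u [^] (n - i) \<otimes> k" using 1 uc by simp
      also have "\<dots> \<in> M"
      proof -
        have "u [^] j \<in> multiplier R M" for j :: nat by (induction j) (use V uV in auto)
        then show ?thesis using k by (simp add: multiplier_def)
      qed
      finally show "u [^] n \<otimes> (inv u [^] i \<otimes> k) \<in> M" .
    qed (use U uc in auto)
    then show False using descend uc M_one by simp
  qed
qed

text \<open>If \<open>\<one>\<close> is a combination of \<open>x\<^sup>0, \<dots>, x\<^sup>n\<^sup>-\<^sup>1\<close> and a combination of at most as many powers of
  \<open>y = x\<^sup>-\<^sup>1\<close>, then the second relation expresses \<open>x\<^sup>n\<^sup>-\<^sup>1\<close> by lower powers, and the first relation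
  can be shortened.\<close>

lemma shorten_relation:
  assumes x: "x \<in> carrier R" and y: "y \<in> carrier R" and xy: "x \<otimes> y = \<one>"
    and n: "\<one> \<in> poly_values M x n" and k: "\<one> \<in> poly_values M y k" and kn: "k \<le> n"
  shows "\<exists>n'<n. \<one> \<in> poly_values M x n'"
proof -
  have "k \<noteq> 0" using k one_not_zero by (cases k) auto
  then obtain k' n' where kn': "k = Suc k'" "n = Suc n'" "k' \<le> n'"
    using kn by (metis Suc_le_D not0_implies_Suc Suc_le_mono)
  have "\<one> \<in> M \<boxplus> ((\<otimes>) y ` poly_values M y k')"
    using poly_values_horner[OF M_hsubgroup y] k kn' by blast
  then obtain m q where m: "m \<in> M" and q: "q \<in> poly_values M y k'" and 1: "\<one> \<in> m \<oplus> (y \<otimes> q)"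
    by (auto simp: set_hadd_iff)
  have qc: "q \<in> carrier R" using q hsubgroup_subset[OF poly_values_hsubgroup[OF y]] by blast
  let ?u = "y \<otimes> q"
  have uc: "?u \<in> carrier R" using y qc by simp
  have "?u \<in> (\<ominus> m) \<oplus> \<one>" using reversible[OF M_carrier[OF m] uc 1] by simp
  \<comment> \<open>The part \<open>u\<close> of the relation for \<open>y\<close> of positive degree in \<open>y\<close> is a unit of the multiplier;
    its product with the power \<open>x [^] n'\<close> involves only lower powers of \<open>x\<close>.\<close>
  then have "?u \<in> \<one> \<oplus> (\<ominus> m)" using hadd_comm M_carrier[OF m] by simp
  note u = inv_one_minus_mem[OF m this]
  have "(x [^] n' \<otimes> y) \<otimes> q \<in> poly_values M x n'"
  proof (rule mult_poly_values_mem[OF y _ poly_values_hsubgroup[OF x] _ q])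
    show "x [^] n' \<otimes> y \<in> carrier R" using x y by simp
    fix i m assume i: "i < k'" and m: "m \<in> M"
    have "x [^] n' = x [^] (n' - Suc i) \<otimes> x [^] Suc i"
      using nat_pow_mult[OF x, of "n' - Suc i" "Suc i"] i kn'(3) by simp
    moreover have "x [^] Suc i \<otimes> y [^] Suc i = \<one>"
      using xy nat_pow_distrib[OF x y, of "Suc i"] nat_pow_one by metis
    moreover have "x [^] n' \<otimes> y \<otimes> (y [^] i \<otimes> m) = x [^] n' \<otimes> y [^] Suc i \<otimes> m"
      using x y M_carrier[OF m] by (simp add: m_ac)
    ultimately have "x [^] n' \<otimes> y \<otimes> (y [^] i \<otimes> m) = x [^] (n' - Suc i) \<otimes> m"
      using x y by (simp add: m_assoc del: nat_pow_Suc)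
    then show "x [^] n' \<otimes> y \<otimes> (y [^] i \<otimes> m) \<in> poly_values M x n'"
      using powers_subset_poly_values[OF x _ m, of "n' - Suc i" n'] i kn'(3) by simp
  qed
  then have "inv ?u \<otimes> (x [^] n' \<otimes> ?u) \<in> poly_values M x n'"
    using multiplier_mult_poly_values[OF x u(2)] x y qc by (simp add: m_assoc)
  moreover have "inv ?u \<otimes> (x [^] n' \<otimes> ?u) = x [^] n' \<otimes> (inv ?u \<otimes> ?u)"
    using u(1) uc x by (intro m_lcomm) auto
  ultimately have top: "x [^] n' \<in> poly_values M x n'" using Units_l_inv[OF u(1)] x by simp
  have "poly_values M x (Suc n') \<subseteq> poly_values M x n'"
  proof (rule partial_hsum_subset[OF poly_values_hsubgroup[OF x]])
    fix i assume "i < Suc n'"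
    then consider "i < n'" | "i = n'" by linarith
    then show "(\<otimes>) (x [^] i) ` M \<subseteq> poly_values M x n'"
    proof cases
      case 1
      then show ?thesis using powers_subset_poly_values[OF x] by blast
    next
      case 2
      then show ?thesis using multiplier_mult_poly_values[OF x _ top] M_subset_multiplier x
          M_carrier by (auto simp: m_comm)
    qed
  qed
  then show ?thesis using n kn' by blast
qed

lemma no_two_relations:
  assumes x: "x \<in> carrier R" and y: "y \<in> carrier R" and xy: "x \<otimes> y = \<one>"
    and "\<one> \<in> poly_values M x n" and "\<one> \<in> poly_values M y k"
  shows False
  using assms(4,5)
proof (induction "n + k" arbitrary: n k rule: less_induct)
  case less
  have yx: "y \<otimes> x = \<one>" using x y xy by (simp add: m_comm)
  show False
  proof (cases "k \<le> n")
    case True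
    then show False using shorten_relation[OF x y xy less.prems] less by (meson add_less_cancel_right)
  next
    case False
    then show False using shorten_relation[OF y x yx less.prems(2,1)] less
      by (meson add_less_cancel_left nle_le)
  qed
qed

lemma hypervaluation_multiplier: "hypervaluation_hyperdomain (multiplier R M) R"
  unfolding hypervaluation_hyperdomain_def
proof (intro conjI ballI subhyperring_multiplier M_hsubgroup)
  fix x assume "x \<in> carrier R - {\<zero>}"
  then have x: "x \<in> carrier R" "x \<in> Units R" using nonzero_Units by auto
  show "x \<in> multiplier R M \<or> inv x \<in> multiplier R M"
    using one_mem_poly_values no_two_relations[of x "inv x"] x Units_inv_closed Units_r_inv by metis
qed

end

text \<open>Existence of hypervaluation hyperdomains with prescribed nonunits: \<open>M\<close> is closed under
  multiplication by \<open>V\<close> and omits \<open>\<one>\<close>, so no element of \<open>M0\<close> is a unit of \<open>V\<close>.\<close>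

theorem exists_hypervaluation:
  assumes A: "A \<subseteq> carrier R" and M0: "nonunital_subhyperring R A M0"
  obtains V M where "hypervaluation_hyperdomain V R" "A \<subseteq> V" "hsubgroup M R" "M0 \<subseteq> M"
    "\<one> \<notin> M" "\<And>v m. v \<in> V \<Longrightarrow> m \<in> M \<Longrightarrow> v \<otimes> m \<in> M"
proof -
  obtain M where M: "nonunital_subhyperring R A M" "M0 \<subseteq> M"
    "\<And>N. nonunital_subhyperring R A N \<Longrightarrow> M \<subseteq> N \<Longrightarrow> N = M"
    using exists_maximal_nonunital_subhyperring[OF M0] by blast
  show ?thesis
  proof (rule that)
    show "hypervaluation_hyperdomain (multiplier R M) R" by (rule hypervaluation_multiplier[OF A M(1,3)])
    show "A \<subseteq> multiplier R M" by (rule A_subset_multiplier[OF A M(1,3)])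
    show "M0 \<subseteq> M" by (rule M)
  qed (use M(1) in \<open>auto simp: nonunital_subhyperring_def multiplier_def\<close>)
qed

text \<open>The elements of \<open>V\<close> without an inverse in \<open>V\<close>.\<close>

definition nonunits :: "'a set \<Rightarrow> 'a set" where
  "nonunits V = {x \<in> V. \<forall>y\<in>V. x \<otimes> y \<noteq> \<one>}"

context
  fixes V :: "'a set"
  assumes V: "hypervaluation_hyperdomain V R"
begin

lemma V_props:
  shows V_hsubgroup: "hsubgroup V R" and V_carrier: "\<And>x. x \<in> V \<Longrightarrow> x \<in> carrier R"
    and V_one: "\<one> \<in> V" and V_mult: "\<And>x y. x \<in> V \<Longrightarrow> y \<in> V \<Longrightarrow> x \<otimes> y \<in> V"
    and V_val: "\<And>x. x \<in> carrier R \<Longrightarrow> x \<noteq> \<zero> \<Longrightarrow> x \<in> V \<or> inv x \<in> V"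
  using V hsubgroup_subset
  by (auto simp: hypervaluation_hyperdomain_def subhyperring_iff)

lemma one_not_nonunit: "\<one> \<notin> nonunits V"
  using V_one by (auto simp: nonunits_def intro!: bexI[of _ \<one>])

lemma mult_nonunits:
  assumes v: "v \<in> V" and m: "m \<in> nonunits V"
  shows "v \<otimes> m \<in> nonunits V"
proof -
  have mV: "m \<in> V" using m by (simp add: nonunits_def)
  have "(v \<otimes> m) \<otimes> y \<noteq> \<one>" if y: "y \<in> V" for y
  proof -
    have "(v \<otimes> m) \<otimes> y = m \<otimes> (v \<otimes> y)" using v mV y V_carrier by (simp add: m_ac)
    then show ?thesis using m V_mult[OF v y] by (simp add: nonunits_def)
  qed
  then show ?thesis using V_mult[OF v mV] by (simp add: nonunits_def)
qed

text \<open>If \<open>y\<close> divides \<open>x\<close> in \<open>V\<close>, then \<open>x + y = y (x / y + \<one>)\<close> consists of multiples of \<open>y\<close>.\<close>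

lemma hadd_nonunits:
  assumes x: "x \<in> nonunits V" and y: "y \<in> nonunits V" and ne: "y \<noteq> \<zero>" and t: "x \<otimes> inv y \<in> V"
  shows "x \<oplus> y \<subseteq> nonunits V"
proof -
  have yV: "y \<in> V" "x \<in> V" using x y by (auto simp: nonunits_def)
  have c: "x \<in> carrier R" "y \<in> carrier R" "y \<in> Units R"
    using yV V_carrier nonzero_Units ne by auto
  have "y \<otimes> (x \<otimes> inv y) = x"
    using c by (simp add: m_lcomm Units_r_inv)
  then have "x \<oplus> y = (\<otimes>) y ` ((x \<otimes> inv y) \<oplus> \<one>)" using c by (simp add: hdistrib)
  moreover have "(x \<otimes> inv y) \<oplus> \<one> \<subseteq> V" using hsubgroup_hadd[OF V_hsubgroup t V_one] .
  moreover have "y \<otimes> w \<in> nonunits V" if "w \<in> V" for w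
    using mult_nonunits[OF that y] c V_carrier[OF that] by (simp add: m_comm)
  ultimately show ?thesis by auto
qed

lemma hsubgroup_nonunits: "hsubgroup (nonunits V) R"
proof (rule hsubgroupI)
  show "nonunits V \<subseteq> carrier R" using V_carrier by (auto simp: nonunits_def)
  show "\<zero> \<in> nonunits V"
    using hsubgroup_zero[OF V_hsubgroup] hzero_mult V_carrier one_not_zero
    by (auto simp: nonunits_def)
  show "\<ominus> x \<in> nonunits V" if x: "x \<in> nonunits V" for x
  proof -
    have c: "x \<in> carrier R" using x V_carrier by (simp add: nonunits_def)
    have "(\<ominus> \<one>) \<otimes> x = \<ominus> x" using mult_hminus[OF c one_closed] c by (simp add: m_comm)
    then show ?thesis using mult_nonunits[OF hsubgroup_hminus[OF V_hsubgroup V_one] x] by simp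
  qed
  show "x \<oplus> y \<subseteq> nonunits V" if x: "x \<in> nonunits V" and y: "y \<in> nonunits V" for x y
  proof (cases "x = \<zero> \<or> y = \<zero>")
    case True
    then show ?thesis using x y V_carrier by (auto simp: nonunits_def hzero_hadd hadd_hzero)
  next
    case False
    have c: "x \<in> carrier R" "y \<in> carrier R" using x y V_carrier by (auto simp: nonunits_def)
    have U: "x \<in> Units R" "y \<in> Units R" using False c nonzero_Units by auto
    then have "x \<otimes> inv y \<in> Units R" by simp
    then have n0: "x \<otimes> inv y \<noteq> \<zero>" using one_not_zero hzero_mult Units_r_inv Units_inv_closed by metis
    have "(x \<otimes> inv y) \<otimes> (y \<otimes> inv x) = (y \<otimes> inv y) \<otimes> (x \<otimes> inv x)"
      using U c by (simp add: m_ac del: Units_r_inv Units_l_inv)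
    then have 1: "(x \<otimes> inv y) \<otimes> (y \<otimes> inv x) = \<one>" using U by (simp add: Units_r_inv)
    moreover from this have "(y \<otimes> inv x) \<otimes> (x \<otimes> inv y) = \<one>" using U c by (simp add: m_comm)
    ultimately have "y \<otimes> inv x = inv (x \<otimes> inv y)"
      using U c by (intro inv_unique') simp_all
    then consider "x \<otimes> inv y \<in> V" | "y \<otimes> inv x \<in> V" using V_val[of "x \<otimes> inv y"] n0 c U by auto
    then show ?thesis
    proof cases
      case 1
      then show ?thesis using hadd_nonunits[OF x y] False by simp
    next
      case 2
      then show ?thesis using hadd_nonunits[OF y x] False hadd_comm[OF c] by simp
    qed
  qed
qed

end

end

section \<open>The quotient hyperfield and the embedding of the hyperdomain\<close>

context krasner_hyperdomain
begin

abbreviation Q :: "('a \<times> 'a) set hyperring" where "Q \<equiv> quot_hyperfield R"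

abbreviation nonzero :: "'a set" where "nonzero \<equiv> carrier R - {\<zero>}"

lemma nonzero_mult: "a \<in> nonzero \<Longrightarrow> b \<in> nonzero \<Longrightarrow> a \<otimes> b \<in> nonzero"
  using integral by auto

lemma frac_carrier: "a \<in> carrier R \<Longrightarrow> b \<in> nonzero \<Longrightarrow> frac R a b \<in> carrier Q"
  by (auto simp: quot_hyperfield_def frac_def intro!: quotientI)

lemma carrier_fracE:
  assumes "X \<in> carrier Q"
  obtains a b where "a \<in> carrier R" "b \<in> nonzero" "X = frac R a b"
  using assms by (auto simp: quot_hyperfield_def frac_def elim!: quotientE)

lemma frac_cancel:
  assumes "a \<in> carrier R" "b \<in> nonzero" "c \<in> nonzero"
  shows "frac R (c \<otimes> a) (c \<otimes> b) = frac R a b"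
  using assms nonzero_mult[of c b] by (subst frac_eq_iff) (auto simp: m_ac)

lemma frac_inj:
  assumes "a \<in> carrier R" "b \<in> carrier R" "d \<in> nonzero" "frac R a d = frac R b d"
  shows "a = b"
  using assms mult_cancel_left[of d a b] by (auto simp: frac_eq_iff m_comm)

lemma common_denominator:
  assumes "X \<in> carrier Q" "Y \<in> carrier Q" "Z \<in> carrier Q"
  obtains a b c d where "a \<in> carrier R" "b \<in> carrier R" "c \<in> carrier R" "d \<in> nonzero"
    "X = frac R a d" "Y = frac R b d" "Z = frac R c d"
proof -
  obtain x p y q z s where c: "x \<in> carrier R" "p \<in> nonzero" "y \<in> carrier R" "q \<in> nonzero"
    "z \<in> carrier R" "s \<in> nonzero" and e: "X = frac R x p" "Y = frac R y q" "Z = frac R z s"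
    using assms by (metis carrier_fracE)
  have c': "p \<in> carrier R" "q \<in> carrier R" "s \<in> carrier R" using c by auto
  let ?d = "p \<otimes> (q \<otimes> s)"
  have d: "?d = (q \<otimes> s) \<otimes> p" "?d = (p \<otimes> s) \<otimes> q" "?d = (p \<otimes> q) \<otimes> s"
    using c' by (simp_all add: m_ac)
  show ?thesis
  proof (rule that)
    show "?d \<in> nonzero" using c by (intro nonzero_mult)
    show "X = frac R ((q \<otimes> s) \<otimes> x) ?d"
      unfolding d(1) e using c by (intro frac_cancel[symmetric] nonzero_mult)
    show "Y = frac R ((p \<otimes> s) \<otimes> y) ?d"
      unfolding d(2) e using c by (intro frac_cancel[symmetric] nonzero_mult)
    show "Z = frac R ((p \<otimes> q) \<otimes> z) ?d"
      unfolding d(3) e using c by (intro frac_cancel[symmetric] nonzero_mult)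
  qed (use c c' in auto)
qed

lemma quot_hadd_common:
  assumes a: "a \<in> carrier R" and b: "b \<in> carrier R" and d: "d \<in> nonzero"
  shows "frac R a d \<oplus>\<^bsub>Q\<^esub> frac R b d = (\<lambda>x. frac R x d) ` (a \<oplus> b)"
proof -
  have dc: "d \<in> carrier R" using d by simp
  have "(a \<otimes> d) \<oplus> (d \<otimes> b) = (\<otimes>) d ` (a \<oplus> b)" using a b dc by (simp add: hdistrib m_comm)
  then have "frac R a d \<oplus>\<^bsub>Q\<^esub> frac R b d = (\<lambda>x. frac R (d \<otimes> x) (d \<otimes> d)) ` (a \<oplus> b)"
    using quot_hadd_frac[OF a d b d] by (simp add: image_image)
  also have "\<dots> = (\<lambda>x. frac R x d) ` (a \<oplus> b)"
    using hadd_closed[OF a b] d by (intro image_cong refl frac_cancel) auto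
  finally show ?thesis .
qed

lemma quot_one: "\<one>\<^bsub>Q\<^esub> = frac R \<one> \<one>"
  by (simp add: quot_hyperfield_def)

lemma quot_hzero: "d \<in> nonzero \<Longrightarrow> \<one> \<noteq> \<zero> \<Longrightarrow> \<zero>\<^bsub>Q\<^esub> = frac R \<zero> d"
  unfolding quot_hyperfield_def
  by (simp, subst frac_eq_iff) (auto simp: hzero_closed hzero_mult mult_hzero)

lemma canonical_hypergroup_quot:
  assumes nz: "\<one> \<noteq> \<zero>"
  shows "canonical_hypergroup Q"
proof -
  have opp: "\<zero>\<^bsub>Q\<^esub> \<in> frac R a d \<oplus>\<^bsub>Q\<^esub> frac R b d \<longleftrightarrow> b = \<ominus> a"
    if c: "a \<in> carrier R" "b \<in> carrier R" "d \<in> nonzero" for a b d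
  proof
    assume "\<zero>\<^bsub>Q\<^esub> \<in> frac R a d \<oplus>\<^bsub>Q\<^esub> frac R b d"
    then obtain x where x: "x \<in> a \<oplus> b" "frac R \<zero> d = frac R x d"
      unfolding quot_hadd_common[OF c] quot_hzero[OF c(3) nz] by blast
    then have "\<zero> = x" using hadd_closed c hzero_closed by (intro frac_inj[of \<zero> x d]) blast+
    then show "b = \<ominus> a" using hminus_unique c x by simp
  next
    assume "b = \<ominus> a"
    then show "\<zero>\<^bsub>Q\<^esub> \<in> frac R a d \<oplus>\<^bsub>Q\<^esub> frac R b d"
      unfolding quot_hadd_common[OF c] quot_hzero[OF c(3) nz] using hadd_hminus c by blast
  qed
  have ex1: "\<exists>!Y. Y \<in> carrier Q \<and> \<zero>\<^bsub>Q\<^esub> \<in> frac R a d \<oplus>\<^bsub>Q\<^esub> Y"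
    if a: "a \<in> carrier R" and d: "d \<in> nonzero" for a d
  proof (rule ex1I)
    show "frac R (\<ominus> a) d \<in> carrier Q \<and> \<zero>\<^bsub>Q\<^esub> \<in> frac R a d \<oplus>\<^bsub>Q\<^esub> frac R (\<ominus> a) d"
      using opp[of a "\<ominus> a" d] a d by (simp add: frac_carrier)
    fix Y assume Y: "Y \<in> carrier Q \<and> \<zero>\<^bsub>Q\<^esub> \<in> frac R a d \<oplus>\<^bsub>Q\<^esub> Y"
    obtain x y s where c: "x \<in> carrier R" "y \<in> carrier R" "s \<in> nonzero"
      and e: "frac R a d = frac R x s" "Y = frac R y s"
      using common_denominator[OF frac_carrier[OF a d] conjunct1[OF Y] conjunct1[OF Y]] by metis
    have y: "y = \<ominus> x" using opp[OF c] Y e by simp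
    have "a \<otimes> s = d \<otimes> x" using e(1) a d c by (simp add: frac_eq_iff)
    then have "s \<otimes> a = d \<otimes> x" using a c by (simp add: m_comm)
    then have "s \<otimes> (\<ominus> a) = d \<otimes> (\<ominus> x)" using a d c by (simp add: mult_hminus)
    then show "Y = frac R (\<ominus> a) d" unfolding e y using a d c
      by (subst frac_eq_iff) (auto simp: m_comm)
  qed
  have min: "\<ominus>\<^bsub>Q\<^esub> (frac R a d) = frac R (\<ominus> a) d" if "a \<in> carrier R" "d \<in> nonzero" for a d
    unfolding hminus_def[of Q]
    by (rule the1_equality[OF ex1[OF that]]) (use opp[of a "\<ominus> a" d] that in \<open>simp add: frac_carrier\<close>)
  have img: "(\<lambda>x. frac R x d) ` A \<boxplus>\<^bsub>Q\<^esub> (\<lambda>x. frac R x d) ` B = (\<lambda>x. frac R x d) ` (A \<boxplus> B)"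
    if "A \<subseteq> carrier R" "B \<subseteq> carrier R" "d \<in> nonzero" for A B d
  proof -
    have "(\<lambda>x. frac R x d) ` A \<boxplus>\<^bsub>Q\<^esub> (\<lambda>x. frac R x d) ` B
      = (\<Union>a\<in>A. \<Union>b\<in>B. frac R a d \<oplus>\<^bsub>Q\<^esub> frac R b d)"
      by (auto simp: set_hadd_def)
    also have "\<dots> = (\<Union>a\<in>A. \<Union>b\<in>B. (\<lambda>x. frac R x d) ` (a \<oplus> b))"
      using that by (intro SUP_cong refl quot_hadd_common) auto
    also have "\<dots> = (\<lambda>x. frac R x d) ` (A \<boxplus> B)" by (auto simp: set_hadd_def)
    finally show ?thesis .
  qed
  show ?thesis
  proof
    fix X Y assume X: "X \<in> carrier Q" and Y: "Y \<in> carrier Q"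
    obtain a b d where c: "a \<in> carrier R" "b \<in> carrier R" "d \<in> nonzero"
      and e: "X = frac R a d" "Y = frac R b d"
      using common_denominator[OF X Y Y] by metis
    note ab = hadd_closed[OF c(1,2)]
    show "X \<oplus>\<^bsub>Q\<^esub> Y \<subseteq> carrier Q"
      unfolding e quot_hadd_common[OF c] using ab c frac_carrier by blast
    show "X \<oplus>\<^bsub>Q\<^esub> Y \<noteq> {}"
      unfolding e quot_hadd_common[OF c] using hadd_nonempty c by simp
    show "X \<oplus>\<^bsub>Q\<^esub> Y = Y \<oplus>\<^bsub>Q\<^esub> X"
      unfolding e using quot_hadd_common[OF c] quot_hadd_common[OF c(2,1,3)] hadd_comm c by simp
    show "Y \<in> (\<ominus>\<^bsub>Q\<^esub> X) \<oplus>\<^bsub>Q\<^esub> Z \<and> X \<in> Z \<oplus>\<^bsub>Q\<^esub> (\<ominus>\<^bsub>Q\<^esub> Y)" if "Z \<in> X \<oplus>\<^bsub>Q\<^esub> Y" for Z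
    proof -
      obtain z where z: "z \<in> a \<oplus> b" "Z = frac R z d"
        using \<open>Z \<in> X \<oplus>\<^bsub>Q\<^esub> Y\<close> unfolding e quot_hadd_common[OF c] by blast
      have zc: "z \<in> carrier R" using z ab by blast
      show ?thesis
        unfolding e z(2) min[OF c(1,3)] min[OF c(2,3)]
          quot_hadd_common[OF hminus_closed[OF c(1)] zc c(3)]
          quot_hadd_common[OF zc hminus_closed[OF c(2)] c(3)]
        using reversible[OF c(1,2) z(1)] by blast
    qed
    show "(X \<oplus>\<^bsub>Q\<^esub> Y) \<boxplus>\<^bsub>Q\<^esub> {Z} = {X} \<boxplus>\<^bsub>Q\<^esub> (Y \<oplus>\<^bsub>Q\<^esub> Z)" if "Z \<in> carrier Q" for Z
    proof -
      obtain x y z s where c: "x \<in> carrier R" "y \<in> carrier R" "z \<in> carrier R" "s \<in> nonzero"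
        and e: "X = frac R x s" "Y = frac R y s" "Z = frac R z s"
        using common_denominator[OF X Y \<open>Z \<in> carrier Q\<close>] by metis
      have "(X \<oplus>\<^bsub>Q\<^esub> Y) \<boxplus>\<^bsub>Q\<^esub> {Z} = (\<lambda>x. frac R x s) ` ((x \<oplus> y) \<boxplus> {z})"
        unfolding e quot_hadd_common[OF c(1,2,4)] using img[of "x \<oplus> y" "{z}" s] c hadd_closed by simp
      also have "\<dots> = (\<lambda>x. frac R x s) ` ({x} \<boxplus> (y \<oplus> z))" using hadd_assoc c by simp
      also have "\<dots> = {X} \<boxplus>\<^bsub>Q\<^esub> (Y \<oplus>\<^bsub>Q\<^esub> Z)"
        unfolding e quot_hadd_common[OF c(2,3,4)] using img[of "{x}" "y \<oplus> z" s] c hadd_closed by simp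
      finally show ?thesis .
    qed
  next
    have one: "\<one> \<in> nonzero" using nz by simp
    show "\<zero>\<^bsub>Q\<^esub> \<in> carrier Q"
      unfolding quot_hzero[OF one nz] using one by (intro frac_carrier hzero_closed)
  next
    fix X assume "X \<in> carrier Q"
    then obtain a d where c: "a \<in> carrier R" "d \<in> nonzero" and e: "X = frac R a d"
      by (rule carrier_fracE)
    show "\<zero>\<^bsub>Q\<^esub> \<oplus>\<^bsub>Q\<^esub> X = {X}"
      unfolding e quot_hzero[OF c(2) nz] quot_hadd_common[OF hzero_closed c] using hzero_hadd c by simp
    show "\<exists>!Y. Y \<in> carrier Q \<and> \<zero>\<^bsub>Q\<^esub> \<in> X \<oplus>\<^bsub>Q\<^esub> Y" unfolding e using ex1[OF c] .
  qed
qed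

lemma comm_monoid_quot:
  assumes nz: "\<one> \<noteq> \<zero>"
  shows "comm_monoid Q"
proof (rule comm_monoidI)
  have one: "\<one> \<in> nonzero" using nz by simp
  show "\<one>\<^bsub>Q\<^esub> \<in> carrier Q" unfolding quot_one using one by (intro frac_carrier) auto
  fix X Y assume "X \<in> carrier Q" "Y \<in> carrier Q"
  then obtain a b c d where c: "a \<in> carrier R" "b \<in> nonzero" "c \<in> carrier R" "d \<in> nonzero"
    and e: "X = frac R a b" "Y = frac R c d"
    by (metis carrier_fracE)
  show "X \<otimes>\<^bsub>Q\<^esub> Y \<in> carrier Q"
    unfolding e quot_mult_frac[OF c] using c by (intro frac_carrier nonzero_mult) auto
  show "X \<otimes>\<^bsub>Q\<^esub> Y = Y \<otimes>\<^bsub>Q\<^esub> X"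
    unfolding e quot_mult_frac[OF c] quot_mult_frac[OF c(3,4,1,2)] using c by (simp add: m_comm)
  show "\<one>\<^bsub>Q\<^esub> \<otimes>\<^bsub>Q\<^esub> X = X"
    unfolding e quot_one using quot_mult_frac[OF one_closed one c(1,2)] c by simp
  show "X \<otimes>\<^bsub>Q\<^esub> Y \<otimes>\<^bsub>Q\<^esub> Z = X \<otimes>\<^bsub>Q\<^esub> (Y \<otimes>\<^bsub>Q\<^esub> Z)" if Z: "Z \<in> carrier Q" for Z
  proof -
    from Z obtain x y where z: "x \<in> carrier R" "y \<in> nonzero" "Z = frac R x y" by (rule carrier_fracE)
    show ?thesis
      unfolding e z quot_mult_frac[OF c] quot_mult_frac[OF c(3,4) z(1,2)]
      using quot_mult_frac[of "a \<otimes> c" "b \<otimes> d" x y] quot_mult_frac[of a b "c \<otimes> x" "d \<otimes> y"]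
        c z nonzero_mult by (simp add: m_assoc)
  qed
qed

theorem krasner_hyperfield_quot:
  assumes nz: "\<one> \<noteq> \<zero>"
  shows "krasner_hyperfield Q"
proof -
  interpret Qh: canonical_hypergroup Q by (rule canonical_hypergroup_quot[OF nz])
  interpret Qm: comm_monoid Q by (rule comm_monoid_quot[OF nz])
  have one: "\<one> \<in> nonzero" using nz by simp
  show ?thesis
  proof
    fix X assume X: "X \<in> carrier Q"
    then obtain e f where c: "e \<in> carrier R" "f \<in> nonzero" and E: "X = frac R e f"
      by (rule carrier_fracE)
    show "X \<otimes>\<^bsub>Q\<^esub> \<zero>\<^bsub>Q\<^esub> = \<zero>\<^bsub>Q\<^esub>"
      unfolding quot_hzero[OF c(2) nz] E quot_mult_frac[OF c hzero_closed c(2)]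
      using c nonzero_mult[OF c(2) c(2)]
      by (subst frac_eq_iff) (auto simp: mult_hzero hzero_mult hzero_closed)
    show "(\<otimes>\<^bsub>Q\<^esub>) X ` (Y \<oplus>\<^bsub>Q\<^esub> Z) = (X \<otimes>\<^bsub>Q\<^esub> Y) \<oplus>\<^bsub>Q\<^esub> (X \<otimes>\<^bsub>Q\<^esub> Z)"
      if Y: "Y \<in> carrier Q" and Z: "Z \<in> carrier Q" for Y Z
    proof -
      obtain a b d where g: "a \<in> carrier R" "b \<in> carrier R" "d \<in> nonzero"
        and YZ: "Y = frac R a d" "Z = frac R b d"
        using common_denominator[OF Y Z Z] by metis
      have "(\<otimes>\<^bsub>Q\<^esub>) X ` (Y \<oplus>\<^bsub>Q\<^esub> Z) = (\<lambda>x. X \<otimes>\<^bsub>Q\<^esub> frac R x d) ` (a \<oplus> b)"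
        unfolding YZ quot_hadd_common[OF g] by (simp add: image_image)
      also have "\<dots> = (\<lambda>x. frac R (e \<otimes> x) (f \<otimes> d)) ` (a \<oplus> b)"
        unfolding E using hadd_closed[OF g(1,2)] c g
        by (intro image_cong refl quot_mult_frac) auto
      also have "\<dots> = (\<lambda>x. frac R x (f \<otimes> d)) ` ((e \<otimes> a) \<oplus> (e \<otimes> b))"
        using c g by (simp add: hdistrib[symmetric] image_image)
      also have "\<dots> = (X \<otimes>\<^bsub>Q\<^esub> Y) \<oplus>\<^bsub>Q\<^esub> (X \<otimes>\<^bsub>Q\<^esub> Z)"
        unfolding E YZ quot_mult_frac[OF c g(1,3)] quot_mult_frac[OF c g(2,3)]
        using c g nonzero_mult by (intro quot_hadd_common[symmetric]) auto
      finally show ?thesis .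
    qed
    show "X \<in> Units Q" if "X \<noteq> \<zero>\<^bsub>Q\<^esub>"
    proof -
      have e: "e \<in> nonzero" using that E quot_hzero[OF c(2) nz] c by auto
      have fe: "f \<in> carrier R" using c by simp
      have Y: "frac R f e \<in> carrier Q" using fe e by (rule frac_carrier)
      have "X \<otimes>\<^bsub>Q\<^esub> frac R f e = frac R (e \<otimes> f) (f \<otimes> e)"
        unfolding E using quot_mult_frac c e fe by simp
      also have "\<dots> = \<one>\<^bsub>Q\<^esub>"
        unfolding quot_one using c e fe one nonzero_mult[OF c(2) e] by (subst frac_eq_iff) (auto simp: m_comm)
      finally have "X \<otimes>\<^bsub>Q\<^esub> frac R f e = \<one>\<^bsub>Q\<^esub>" .
      then show ?thesis using X Y Qm.m_comm[OF X Y] unfolding Units_def by auto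
    qed
  next
    show "\<one>\<^bsub>Q\<^esub> \<noteq> \<zero>\<^bsub>Q\<^esub>"
      unfolding quot_one quot_hzero[OF one nz] using frac_inj[of \<one> \<zero> \<one>] one nz hzero_closed by auto
  qed
qed

lemma quot_embed_props:
  assumes nz: "\<one> \<noteq> \<zero>"
  shows quot_embed_closed: "x \<in> carrier R \<Longrightarrow> quot_embed R x \<in> carrier Q"
    and quot_embed_inj: "x \<in> carrier R \<Longrightarrow> y \<in> carrier R \<Longrightarrow> quot_embed R x = quot_embed R y \<Longrightarrow> x = y"
    and quot_embed_mult: "x \<in> carrier R \<Longrightarrow> y \<in> carrier R \<Longrightarrow>
      quot_embed R (x \<otimes> y) = quot_embed R x \<otimes>\<^bsub>Q\<^esub> quot_embed R y"
    and quot_embed_hadd: "x \<in> carrier R \<Longrightarrow> y \<in> carrier R \<Longrightarrow>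
      quot_embed R ` (x \<oplus> y) = quot_embed R x \<oplus>\<^bsub>Q\<^esub> quot_embed R y"
    and quot_embed_hzero: "quot_embed R \<zero> = \<zero>\<^bsub>Q\<^esub>"
    and quot_embed_one: "quot_embed R \<one> = \<one>\<^bsub>Q\<^esub>"
proof -
  have one: "\<one> \<in> nonzero" using nz by simp
  show "x \<in> carrier R \<Longrightarrow> quot_embed R x \<in> carrier Q"
    unfolding quot_embed_def using one frac_carrier by blast
  show "x \<in> carrier R \<Longrightarrow> y \<in> carrier R \<Longrightarrow> quot_embed R x = quot_embed R y \<Longrightarrow> x = y"
    unfolding quot_embed_def using frac_inj one by blast
  show "x \<in> carrier R \<Longrightarrow> y \<in> carrier R \<Longrightarrow>
      quot_embed R (x \<otimes> y) = quot_embed R x \<otimes>\<^bsub>Q\<^esub> quot_embed R y"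
    unfolding quot_embed_def using quot_mult_frac one by simp
  show "x \<in> carrier R \<Longrightarrow> y \<in> carrier R \<Longrightarrow>
      quot_embed R ` (x \<oplus> y) = quot_embed R x \<oplus>\<^bsub>Q\<^esub> quot_embed R y"
    unfolding quot_embed_def using quot_hadd_common one by simp
  show "quot_embed R \<zero> = \<zero>\<^bsub>Q\<^esub>" "quot_embed R \<one> = \<one>\<^bsub>Q\<^esub>"
    unfolding quot_embed_def using quot_hzero[OF one nz] quot_one by auto
qed

end

section \<open>Integral closure and hypervaluation hyperdomains\<close>

context krasner_hyperring
begin

lemma hpower_mult:
  assumes I: "hyperideal I R" and a: "a \<in> hpower R I (Suc i)" and b: "b \<in> hpower R I (Suc j)"
  shows "a \<otimes> b \<in> hpower R I (Suc (Suc (i + j)))"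
  using b
proof (induction j arbitrary: b)
  have c: "hpower R I n \<subseteq> carrier R" for n
    using hyperideal_hpower[OF I] hsubgroup_subset by (auto simp: hyperideal_iff)
  have Ic: "I \<subseteq> carrier R" using c[of 1] by simp
  {
    case 0
    then show ?case using hprod_mult[OF c Ic a] by simp
  next
    case (Suc j)
    have "a \<otimes> (p \<otimes> d) \<in> hprod R (hpower R I (Suc (Suc (i + j)))) I"
      if p: "p \<in> hpower R I (Suc j)" and d: "d \<in> I" for p d
    proof -
      have "(a \<otimes> p) \<otimes> d = a \<otimes> (p \<otimes> d)" using a p d c Ic by (intro m_assoc) blast+
      then show ?thesis using hprod_mult[OF c Ic Suc.IH[OF p] d] by simp
    qed
    moreover have "hsubgroup (hprod R (hpower R I (Suc (Suc (i + j)))) I) R"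
      using hyperideal_hpower[OF I, of "Suc (Suc (Suc (i + j)))"] by (simp add: hyperideal_iff)
    moreover have "b \<in> hprod R (hpower R I (Suc j)) I" using Suc.prems by simp
    moreover have "a \<in> carrier R" using a c by blast
    ultimately have "a \<otimes> b \<in> hprod R (hpower R I (Suc (Suc (i + j)))) I"
      using mult_hprod_mem[OF _ c[of "Suc j"] Ic] by blast
    then show ?case by simp
  }
qed

end

text \<open>The zero hyperring satisfies the axioms of a hyperdomain but has no hyperfield of fractions.\<close>

locale nonzero_krasner_hyperdomain = krasner_hyperdomain R
  for R :: "('a, 'm) hyperring_scheme" (structure) +
  assumes one_neq_zero: "\<one> \<noteq> \<zero>"

sublocale nonzero_krasner_hyperdomain \<subseteq> Q: krasner_hyperfield Q
  by (rule krasner_hyperfield_quot[OF one_neq_zero])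

context nonzero_krasner_hyperdomain
begin

abbreviation \<phi> :: "'a \<Rightarrow> ('a \<times> 'a) set" where "\<phi> \<equiv> quot_embed R"

lemmas embed_simps [simp] = quot_embed_props(1,3,5,6)[OF one_neq_zero]

lemmas embed_inj = quot_embed_inj[OF one_neq_zero]

lemmas embed_hadd = quot_embed_hadd[OF one_neq_zero]

lemma embed_hminus: "x \<in> carrier R \<Longrightarrow> \<phi> (\<ominus> x) = \<ominus>\<^bsub>Q\<^esub> (\<phi> x)"
  using Q.hminus_unique[of "\<phi> x" "\<phi> (\<ominus> x)"] embed_hadd[of x "\<ominus> x"] hadd_hminus[of x]
    embed_simps(3) by (metis embed_simps(1) hminus_closed imageI)

lemma embed_nat_pow: "x \<in> carrier R \<Longrightarrow> \<phi> (x [^] (n::nat)) = \<phi> x [^]\<^bsub>Q\<^esub> n"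
  by (induction n) simp_all

lemma embed_set_hadd:
  assumes "A \<subseteq> carrier R" "B \<subseteq> carrier R"
  shows "\<phi> ` (A \<boxplus> B) = \<phi> ` A \<boxplus>\<^bsub>Q\<^esub> \<phi> ` B"
proof -
  have "\<phi> ` (A \<boxplus> B) = (\<Union>a\<in>A. \<Union>b\<in>B. \<phi> ` (a \<oplus> b))" by (auto simp: set_hadd_def)
  also have "\<dots> = (\<Union>a\<in>A. \<Union>b\<in>B. \<phi> a \<oplus>\<^bsub>Q\<^esub> \<phi> b)"
    using assms by (intro SUP_cong refl embed_hadd) auto
  also have "\<dots> = \<phi> ` A \<boxplus>\<^bsub>Q\<^esub> \<phi> ` B" by (auto simp: set_hadd_def)
  finally show ?thesis .
qed

lemma embed_hsum_list:
  "set xs \<subseteq> carrier R \<Longrightarrow> \<phi> ` hsum_list R xs = hsum_list Q (map \<phi> xs)"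
  by (induction xs) (simp_all add: embed_set_hadd hsum_list_closed)

lemma hsubgroup_embed:
  assumes A: "hsubgroup A R"
  shows "hsubgroup (\<phi> ` A) Q"
proof (rule Q.hsubgroupI)
  note c = hsubgroup_subset[OF A]
  show "\<phi> ` A \<subseteq> carrier Q" using c by auto
  show "\<zero>\<^bsub>Q\<^esub> \<in> \<phi> ` A" using hsubgroup_zero[OF A] embed_simps(3) by (metis imageI)
  show "x \<oplus>\<^bsub>Q\<^esub> y \<subseteq> \<phi> ` A" if xy: "x \<in> \<phi> ` A" "y \<in> \<phi> ` A" for x y
  proof -
    from xy obtain a b where ab: "x = \<phi> a" "y = \<phi> b" "a \<in> A" "b \<in> A" by blast
    then have "x \<oplus>\<^bsub>Q\<^esub> y = \<phi> ` (a \<oplus> b)" using embed_hadd c by blast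
    then show ?thesis using hsubgroup_hadd[OF A ab(3,4)] by blast
  qed
  show "\<ominus>\<^bsub>Q\<^esub> x \<in> \<phi> ` A" if "x \<in> \<phi> ` A" for x
  proof -
    from that obtain a where a: "x = \<phi> a" "a \<in> A" by blast
    then have "\<ominus>\<^bsub>Q\<^esub> x = \<phi> (\<ominus> a)" using embed_hminus[of a] c by auto
    then show ?thesis using hsubgroup_hminus[OF A a(2)] by blast
  qed
qed

lemma hsubgroup_embed_vimage:
  assumes M: "hsubgroup M Q" and w: "w \<in> carrier Q"
  shows "hsubgroup {x \<in> carrier R. w \<otimes>\<^bsub>Q\<^esub> \<phi> x \<in> M} R" (is "hsubgroup ?C R")
proof (rule hsubgroupI)
  show "?C \<subseteq> carrier R" by blast
  show "\<zero> \<in> ?C" using Q.mult_hzero[OF w] Q.hsubgroup_zero[OF M] hzero_closed by simp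
  show "x \<oplus> y \<subseteq> ?C" if xy: "x \<in> ?C" "y \<in> ?C" for x y
  proof
    fix z assume z: "z \<in> x \<oplus> y"
    then have "\<phi> z \<in> \<phi> x \<oplus>\<^bsub>Q\<^esub> \<phi> y" using embed_hadd xy by blast
    then have "w \<otimes>\<^bsub>Q\<^esub> \<phi> z \<in> (w \<otimes>\<^bsub>Q\<^esub> \<phi> x) \<oplus>\<^bsub>Q\<^esub> (w \<otimes>\<^bsub>Q\<^esub> \<phi> y)"
      using xy w by (intro Q.mult_mem_hadd) auto
    then have "w \<otimes>\<^bsub>Q\<^esub> \<phi> z \<in> M" using Q.hsubgroup_hadd[OF M] xy by blast
    then show "z \<in> ?C" using z xy hadd_closed by blast
  qed
  show "\<ominus> x \<in> ?C" if x: "x \<in> ?C" for x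
    using x w Q.mult_hminus[OF w] Q.hsubgroup_hminus[OF M] by (simp add: embed_hminus)
qed

lemma embed_Units:
  assumes "r \<in> carrier R" "r \<noteq> \<zero>"
  shows "\<phi> r \<in> Units Q"
proof (rule Q.nonzero_Units)
  show "\<phi> r \<noteq> \<zero>\<^bsub>Q\<^esub>" using embed_inj[of r \<zero>] assms hzero_closed by auto
qed (use assms in simp)

lemma inv_embed_pow:
  fixes i n :: nat
  assumes r: "r \<in> carrier R" "r \<noteq> \<zero>" and i: "i \<le> n"
  shows "(inv\<^bsub>Q\<^esub> \<phi> r) [^]\<^bsub>Q\<^esub> n \<otimes>\<^bsub>Q\<^esub> \<phi> (r [^] (n - i)) = (inv\<^bsub>Q\<^esub> \<phi> r) [^]\<^bsub>Q\<^esub> i"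
    and "\<phi> (r [^] n) \<otimes>\<^bsub>Q\<^esub> (inv\<^bsub>Q\<^esub> \<phi> r) [^]\<^bsub>Q\<^esub> i = \<phi> (r [^] (n - i))"
proof -
  let ?s = "inv\<^bsub>Q\<^esub> \<phi> r"
  have U: "\<phi> r \<in> Units Q" using embed_Units r by simp
  have s: "?s \<in> carrier Q" and p: "\<phi> r \<in> carrier Q" using U r by auto
  have 1: "?s [^]\<^bsub>Q\<^esub> k \<otimes>\<^bsub>Q\<^esub> \<phi> r [^]\<^bsub>Q\<^esub> k = \<one>\<^bsub>Q\<^esub>" for k :: nat
    using Q.nat_pow_distrib[OF s p] Q.Units_l_inv[OF U] Q.nat_pow_one by metis
  have n: "?s [^]\<^bsub>Q\<^esub> n = ?s [^]\<^bsub>Q\<^esub> i \<otimes>\<^bsub>Q\<^esub> ?s [^]\<^bsub>Q\<^esub> (n - i)"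
    "\<phi> r [^]\<^bsub>Q\<^esub> n = \<phi> r [^]\<^bsub>Q\<^esub> (n - i) \<otimes>\<^bsub>Q\<^esub> \<phi> r [^]\<^bsub>Q\<^esub> i"
    using Q.nat_pow_mult[OF s, of i "n - i"] Q.nat_pow_mult[OF p, of "n - i" i] i by simp_all
  show "?s [^]\<^bsub>Q\<^esub> n \<otimes>\<^bsub>Q\<^esub> \<phi> (r [^] (n - i)) = ?s [^]\<^bsub>Q\<^esub> i"
    using 1[of "n - i"] s p r unfolding n by (simp add: embed_nat_pow Q.m_assoc)
  have "\<phi> r [^]\<^bsub>Q\<^esub> i \<otimes>\<^bsub>Q\<^esub> ?s [^]\<^bsub>Q\<^esub> i = \<one>\<^bsub>Q\<^esub>"
    using 1[of i] s p by (simp add: Q.m_comm)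
  then show "\<phi> (r [^] n) \<otimes>\<^bsub>Q\<^esub> ?s [^]\<^bsub>Q\<^esub> i = \<phi> (r [^] (n - i))"
    unfolding embed_nat_pow[OF r(1)] n(2) using s p by (simp add: Q.m_assoc)
qed

context
  fixes I :: "'a set"
  assumes I: "hyperideal I R"
begin

lemma hpower_hsubgroup: "hsubgroup (hpower R I n) R"
  using hyperideal_hpower[OF I] by (simp add: hyperideal_iff)

lemma hpower_carrier: "a \<in> hpower R I n \<Longrightarrow> a \<in> carrier R"
  using hsubgroup_subset[OF hpower_hsubgroup] by blast

lemma I_hsubgroup: "hsubgroup I R"
  using I by (simp add: hyperideal_iff)

lemma I_carrier: "a \<in> I \<Longrightarrow> a \<in> carrier R"
  using hsubgroup_subset[OF I_hsubgroup] by blast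

lemma zero_mem_extension:
  assumes "V \<in> hypervaluations R"
  shows "\<zero>\<^bsub>Q\<^esub> \<in> hyperideal_extension R I V"
proof -
  have V: "V \<subseteq> carrier Q" "\<one>\<^bsub>Q\<^esub> \<in> V"
    using assms by (auto simp: hypervaluations_def hypervaluation_hyperdomain_def subhyperring_def)
  have "\<phi> \<zero> \<otimes>\<^bsub>Q\<^esub> \<one>\<^bsub>Q\<^esub> \<in> hprod Q (\<phi> ` I) V"
    using V hsubgroup_zero[OF I_hsubgroup] I_carrier by (intro Q.hprod_mult imageI) auto
  then show ?thesis by (simp add: hyperideal_extension_def Q.hzero_closed)
qed

lemma integral_closure_subset_extension:
  assumes r: "r \<in> integral_closure R I" and V: "V \<in> hypervaluations R"
  shows "\<phi> r \<in> hyperideal_extension R I V"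
proof (rule ccontr)
  assume no: "\<phi> r \<notin> hyperideal_extension R I V"
  have hv: "hypervaluation_hyperdomain V Q" and RV: "\<And>x. x \<in> carrier R \<Longrightarrow> \<phi> x \<in> V"
    using V by (auto simp: hypervaluations_def)
  note Vp = Q.V_props[OF hv]
  let ?M = "Q.nonunits V"
  note M = Q.hsubgroup_nonunits[OF hv]
  have rc: "r \<in> carrier R" using r by (simp add: integral_closure_def)
  have r0: "r \<noteq> \<zero>" using no zero_mem_extension[OF V] by auto
  let ?s = "inv\<^bsub>Q\<^esub> \<phi> r"
  have U: "\<phi> r \<in> Units Q" using embed_Units rc r0 .
  have s: "?s \<in> carrier Q" using U by simp
  \<comment> \<open>If \<open>a / r\<close> had an inverse \<open>y\<close> in \<open>V\<close>, then \<open>r = a y\<close> would lie in \<open>IV\<close>.\<close>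
  have no_inv: "(?s \<otimes>\<^bsub>Q\<^esub> \<phi> a) \<otimes>\<^bsub>Q\<^esub> y \<noteq> \<one>\<^bsub>Q\<^esub>" if a: "a \<in> I" and y: "y \<in> V" for a y
  proof
    assume 1: "(?s \<otimes>\<^bsub>Q\<^esub> \<phi> a) \<otimes>\<^bsub>Q\<^esub> y = \<one>\<^bsub>Q\<^esub>"
    have c: "\<phi> a \<in> carrier Q" "y \<in> carrier Q" "\<phi> r \<in> carrier Q"
      using I_carrier[OF a] Vp(2)[OF y] rc by auto
    have "\<phi> r = \<phi> r \<otimes>\<^bsub>Q\<^esub> ((?s \<otimes>\<^bsub>Q\<^esub> \<phi> a) \<otimes>\<^bsub>Q\<^esub> y)" using 1 c by simp
    also have "\<dots> = (\<phi> r \<otimes>\<^bsub>Q\<^esub> ?s) \<otimes>\<^bsub>Q\<^esub> (\<phi> a \<otimes>\<^bsub>Q\<^esub> y)"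
      using c s by (simp add: Q.m_assoc del: Q.Units_r_inv)
    also have "\<dots> = \<phi> a \<otimes>\<^bsub>Q\<^esub> y" using U c by simp
    also have "\<dots> \<in> hprod Q (\<phi> ` I) V"
      using a y I_carrier Vp(2) by (intro Q.hprod_mult) auto
    finally show False using no by (simp add: hyperideal_extension_def)
  qed
  have base: "?s \<otimes>\<^bsub>Q\<^esub> \<phi> a \<in> ?M" if a: "a \<in> I" for a
  proof -
    let ?x = "?s \<otimes>\<^bsub>Q\<^esub> \<phi> a"
    have xc: "?x \<in> carrier Q" using s I_carrier[OF a] by simp
    have "?x \<in> V"
    proof (rule ccontr)
      assume nx: "?x \<notin> V"
      then have x0: "?x \<noteq> \<zero>\<^bsub>Q\<^esub>" using Q.hsubgroup_zero[OF Vp(1)] by metis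
      then have "inv\<^bsub>Q\<^esub> ?x \<in> V" using Vp(5)[OF xc] nx by blast
      then show False using no_inv[OF a] Q.Units_r_inv[OF Q.nonzero_Units[OF xc x0]] by blast
    qed
    then show ?thesis using no_inv[OF a] by (simp add: Q.nonunits_def)
  qed
  have hpow: "b \<in> hpower R I (Suc i) \<Longrightarrow> ?s [^]\<^bsub>Q\<^esub> Suc i \<otimes>\<^bsub>Q\<^esub> \<phi> b \<in> ?M" for b i
  proof (induction i arbitrary: b)
    case 0
    then show ?case using base s by simp
  next
    case (Suc i)
    let ?C = "{x \<in> carrier R. ?s [^]\<^bsub>Q\<^esub> Suc (Suc i) \<otimes>\<^bsub>Q\<^esub> \<phi> x \<in> ?M}"
    have "hprod R (hpower R I (Suc i)) I \<subseteq> ?C"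
    proof (rule hprod_subset)
      show "hsubgroup ?C R" by (rule hsubgroup_embed_vimage[OF M]) (use s in simp)
      fix a b assume a: "a \<in> hpower R I (Suc i)" and b: "b \<in> I"
      note c = hpower_carrier[OF a] I_carrier[OF b]
      have "?s [^]\<^bsub>Q\<^esub> Suc (Suc i) \<otimes>\<^bsub>Q\<^esub> \<phi> (a \<otimes> b)
        = (?s [^]\<^bsub>Q\<^esub> Suc i \<otimes>\<^bsub>Q\<^esub> \<phi> a) \<otimes>\<^bsub>Q\<^esub> (?s \<otimes>\<^bsub>Q\<^esub> \<phi> b)"
        using c s by (simp add: Q.m_ac)
      also have "\<dots> \<in> ?M"
        using Suc.IH[OF a] base[OF b] Q.mult_nonunits[OF hv] by (simp add: Q.nonunits_def)
      finally show "a \<otimes> b \<in> ?C" using c by simp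
    qed
    then show ?case using Suc.prems by auto
  qed
  \<comment> \<open>The tail of the equation, divided by \<open>r\<^sup>n\<close>, consists of nonunits; but it contains \<open>-r\<^sup>n / r\<^sup>n\<close>.\<close>
  obtain n a where a: "\<And>i. i \<in> {1..n} \<Longrightarrow> a i \<in> hpower R I i"
    and eq: "\<zero> \<in> hsum_list R (r [^] n # map (\<lambda>i. a i \<otimes> r [^] (n - i)) [1..<Suc n])"
    using r unfolding integral_closure_def by blast
  let ?C = "{x \<in> carrier R. ?s [^]\<^bsub>Q\<^esub> n \<otimes>\<^bsub>Q\<^esub> \<phi> x \<in> ?M}"
  have C: "hsubgroup ?C R" by (rule hsubgroup_embed_vimage[OF M]) (use s in simp)
  have "a i \<otimes> r [^] (n - i) \<in> ?C" if i: "i \<in> {1..n}" for i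
  proof -
    have ac: "a i \<in> carrier R" using hpower_carrier[OF a[OF i]] .
    have "?s [^]\<^bsub>Q\<^esub> n \<otimes>\<^bsub>Q\<^esub> \<phi> (a i \<otimes> r [^] (n - i))
      = (?s [^]\<^bsub>Q\<^esub> n \<otimes>\<^bsub>Q\<^esub> \<phi> (r [^] (n - i))) \<otimes>\<^bsub>Q\<^esub> \<phi> (a i)"
      using ac rc s by (simp add: Q.m_ac)
    also have "\<dots> = ?s [^]\<^bsub>Q\<^esub> i \<otimes>\<^bsub>Q\<^esub> \<phi> (a i)"
      using inv_embed_pow(1)[OF rc r0, of i n] i by simp
    also have "\<dots> \<in> ?M" using hpow[of "a i" "i - 1"] a[OF i] i by (cases i) simp_all
    finally show ?thesis using ac rc by simp
  qed
  then have "hsum_list R (map (\<lambda>i. a i \<otimes> r [^] (n - i)) [1..<Suc n]) \<subseteq> ?C"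
    by (intro hsum_list_subset[OF C]) (auto simp del: upt_Suc)
  then obtain t where t: "t \<in> ?C" "\<zero> \<in> r [^] n \<oplus> t"
    using eq by (auto simp: set_hadd_iff simp del: upt_Suc)
  then have "r [^] n = \<ominus> t"
    using hminus_unique[of "r [^] n" t] rc by (metis (lifting) hminus_hminus mem_Collect_eq nat_pow_closed)
  then have "r [^] n \<in> ?C" using hsubgroup_hminus[OF C t(1)] by simp
  then have "\<one>\<^bsub>Q\<^esub> \<in> ?M" using inv_embed_pow(1)[OF rc r0, of 0 n] by simp
  then show False using Q.one_not_nonunit[OF hv] by simp
qed

text \<open>Clearing denominators in a relation \<open>\<one> \<in> b\<^sub>0 / r + b\<^sub>1 / r\<^sup>2 + \<dots>\<close> gives an equation of integral
  dependence with coefficients \<open>a\<^sub>i = - b\<^sub>i\<^sub>-\<^sub>1\<close>.\<close>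

lemma integral_closureI:
  assumes r: "r \<in> carrier R" "r \<noteq> \<zero>"
    and b: "\<And>i. i < n \<Longrightarrow> b i \<in> hpower R I (Suc i)"
    and eq: "\<one>\<^bsub>Q\<^esub> \<in> hsum_list Q (map (\<lambda>i. (inv\<^bsub>Q\<^esub> \<phi> r) [^]\<^bsub>Q\<^esub> Suc i \<otimes>\<^bsub>Q\<^esub> \<phi> (b i)) [0..<n])"
  shows "r \<in> integral_closure R I"
proof -
  let ?s = "inv\<^bsub>Q\<^esub> \<phi> r"
  let ?xs = "map (\<lambda>i. b i \<otimes> r [^] (n - Suc i)) [0..<n]"
  have s: "?s \<in> carrier Q" using embed_Units[OF r] by simp
  have bc: "b i \<in> carrier R" if "i < n" for i using hpower_carrier[OF b[OF that]] .
  have rn: "\<phi> (r [^] n) \<in> carrier Q" using r by simp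
  have xs: "set ?xs \<subseteq> carrier R" using bc r by auto
  have "\<phi> (r [^] n) \<otimes>\<^bsub>Q\<^esub> \<one>\<^bsub>Q\<^esub> \<in> hsum_list Q (map ((\<otimes>\<^bsub>Q\<^esub>) (\<phi> (r [^] n)))
    (map (\<lambda>i. ?s [^]\<^bsub>Q\<^esub> Suc i \<otimes>\<^bsub>Q\<^esub> \<phi> (b i)) [0..<n]))"
    using eq s bc by (subst Q.mult_hsum_list[OF rn, symmetric]) (auto simp del: nat_pow_Suc)
  also have "map ((\<otimes>\<^bsub>Q\<^esub>) (\<phi> (r [^] n))) (map (\<lambda>i. ?s [^]\<^bsub>Q\<^esub> Suc i \<otimes>\<^bsub>Q\<^esub> \<phi> (b i)) [0..<n])
    = map \<phi> ?xs"
  proof -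
    have "\<phi> (r [^] n) \<otimes>\<^bsub>Q\<^esub> (?s [^]\<^bsub>Q\<^esub> Suc i \<otimes>\<^bsub>Q\<^esub> \<phi> (b i)) = \<phi> (b i \<otimes> r [^] (n - Suc i))"
      if i: "i < n" for i
    proof -
      have "\<phi> (r [^] n) \<otimes>\<^bsub>Q\<^esub> (?s [^]\<^bsub>Q\<^esub> Suc i \<otimes>\<^bsub>Q\<^esub> \<phi> (b i))
        = (\<phi> (r [^] n) \<otimes>\<^bsub>Q\<^esub> ?s [^]\<^bsub>Q\<^esub> Suc i) \<otimes>\<^bsub>Q\<^esub> \<phi> (b i)"
        using rn s bc[OF i] by (intro Q.m_assoc[symmetric]) auto
      also have "\<dots> = \<phi> (r [^] (n - Suc i)) \<otimes>\<^bsub>Q\<^esub> \<phi> (b i)"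
        using inv_embed_pow(2)[OF r, of "Suc i" n] i by simp
      also have "\<dots> = \<phi> (b i \<otimes> r [^] (n - Suc i))" using bc[OF i] r by (simp add: Q.m_comm)
      finally show ?thesis .
    qed
    then show ?thesis by simp
  qed
  finally have "\<phi> (r [^] n) \<in> \<phi> ` hsum_list R ?xs" using embed_hsum_list[OF xs] rn by simp
  then obtain t where t: "t \<in> hsum_list R ?xs" "\<phi> (r [^] n) = \<phi> t" by blast
  then have "r [^] n = t" using hsum_list_closed[OF xs] r by (intro embed_inj) auto
  then have "r [^] n \<in> hsum_list R ?xs" using t by simp
  then have "(\<ominus> \<one>) \<otimes> r [^] n \<in> hsum_list R (map ((\<otimes>) (\<ominus> \<one>)) ?xs)"
    using mult_hsum_list[OF _ xs, of "\<ominus> \<one>"] by auto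
  moreover have neg: "(\<ominus> \<one>) \<otimes> x = \<ominus> x" if "x \<in> carrier R" for x
    using mult_hminus[OF that one_closed] that by (simp add: m_comm)
  ultimately have mem: "\<ominus> (r [^] n) \<in> hsum_list R (map ((\<otimes>) (\<ominus> \<one>)) ?xs)" using r by simp
  define a where "a = (\<lambda>i. (\<ominus> \<one>) \<otimes> b (i - 1))"
  have a: "a i \<in> hpower R I i" if "i \<in> {1..n}" for i
  proof -
    have "b (i - 1) \<in> hpower R I i" using b[of "i - 1"] that by (cases i) simp_all
    then show ?thesis unfolding a_def
      using neg hpower_carrier hsubgroup_hminus[OF hpower_hsubgroup] by simp
  qed
  have "map (\<lambda>i. a i \<otimes> r [^] (n - i)) [1..<Suc n] = map (\<lambda>i. a (Suc i) \<otimes> r [^] (n - Suc i)) [0..<n]"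
    by (simp add: map_Suc_upt[symmetric] del: upt_Suc)
  also have "\<dots> = map ((\<otimes>) (\<ominus> \<one>)) ?xs"
    using bc r by (simp add: a_def m_assoc)
  finally have "\<zero> \<in> hsum_list R (r [^] n # map (\<lambda>i. a i \<otimes> r [^] (n - i)) [1..<Suc n])"
    using mem hadd_hminus[of "r [^] n"] r by (auto simp: set_hadd_iff simp del: upt_Suc)
  moreover have "n \<ge> 1" using eq Q.one_not_zero by (cases n) auto
  ultimately show ?thesis using a r unfolding integral_closure_def by blast
qed

text \<open>If \<open>r\<close> is not integral over \<open>I\<close>, the elements \<open>b / r\<^sup>i\<close> with \<open>b \<in> I\<^sup>i\<close>, \<open>i \<ge> 1\<close>, can be made
  nonunits of a hypervaluation hyperdomain.\<close>

lemma exists_hypervaluation_not_mem_extension: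
  assumes r: "r \<in> carrier R" and ni: "r \<notin> integral_closure R I"
  obtains V where "V \<in> hypervaluations R" "\<phi> r \<notin> hyperideal_extension R I V"
proof -
  have r0: "r \<noteq> \<zero>"
  proof
    assume "r = \<zero>"
    then have "\<zero> \<in> hsum_list R (r [^] (1::nat) # map (\<lambda>i. \<zero> \<otimes> r [^] (1 - i)) [1..<Suc 1])"
      by (simp add: hzero_closed mult_hzero hzero_hadd)
    then have "r \<in> integral_closure R I"
      unfolding integral_closure_def
      using r hsubgroup_zero[OF hpower_hsubgroup] hsubgroup_zero[OF I_hsubgroup]
      by (intro CollectI conjI exI[of _ "1::nat"] exI[of _ "\<lambda>i. \<zero>"]) auto
    then show False using ni by simp
  qed
  let ?s = "inv\<^bsub>Q\<^esub> \<phi> r"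
  have U: "\<phi> r \<in> Units Q" using embed_Units r r0 .
  have s: "?s \<in> carrier Q" using U by simp
  \<comment> \<open>\<open>F i\<close> is \<open>I\<^sup>i\<^sup>+\<^sup>1 / r\<^sup>i\<^sup>+\<^sup>1\<close>; the shift leaves out the power with exponent \<open>0\<close>.\<close>
  define F where "F = (\<lambda>i. (\<otimes>\<^bsub>Q\<^esub>) (?s [^]\<^bsub>Q\<^esub> Suc i) ` \<phi> ` hpower R I (Suc i))"
  define M0 where "M0 = (\<Union>n. partial_hsum Q F n)"
  have F: "hsubgroup (F i) Q" for i
    unfolding F_def using s hpower_hsubgroup by (intro Q.hsubgroup_mult hsubgroup_embed) auto
  have M0: "hsubgroup M0 Q" unfolding M0_def by (rule Q.hsubgroup_Union_partial_hsum) (rule F)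
  have FM0: "F i \<subseteq> M0" for i
    unfolding M0_def using Q.summand_subset_partial_hsum[of F i "Suc i", OF F] by blast
  have "nonunital_subhyperring Q (\<phi> ` carrier R) M0"
    unfolding nonunital_subhyperring_def
  proof (intro conjI ballI M0 notI)
    assume "\<one>\<^bsub>Q\<^esub> \<in> M0"
    then obtain n f where f: "\<forall>i<n. f i \<in> F i" "\<one>\<^bsub>Q\<^esub> \<in> hsum_list Q (map f [0..<n])"
      unfolding M0_def using Q.partial_hsum_hsum_list[of F, OF F] by blast
    have "\<forall>i. \<exists>b. i < n \<longrightarrow> b \<in> hpower R I (Suc i) \<and> f i = ?s [^]\<^bsub>Q\<^esub> Suc i \<otimes>\<^bsub>Q\<^esub> \<phi> b"
      using f(1) unfolding F_def by blast
    then obtain b where b: "\<And>i. i < n \<Longrightarrow> b i \<in> hpower R I (Suc i)"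
      "\<And>i. i < n \<Longrightarrow> f i = ?s [^]\<^bsub>Q\<^esub> Suc i \<otimes>\<^bsub>Q\<^esub> \<phi> (b i)" by metis
    have eq: "map f [0..<n] = map (\<lambda>i. ?s [^]\<^bsub>Q\<^esub> Suc i \<otimes>\<^bsub>Q\<^esub> \<phi> (b i)) [0..<n]"
      by (rule map_cong) (use b(2) in auto)
    show False using integral_closureI[where b = b, OF r r0 b(1) f(2)[unfolded eq]] ni by blast
  next
    fix x y assume x: "x \<in> M0" and y: "y \<in> M0"
    show "x \<otimes>\<^bsub>Q\<^esub> y \<in> M0"
    proof (rule Q.mult_Union_partial_hsum[of F, OF F M0 _ x[unfolded M0_def] y[unfolded M0_def]])
      fix i j u v assume "u \<in> F i" "v \<in> F j"
      then obtain a b where ab: "a \<in> hpower R I (Suc i)" "b \<in> hpower R I (Suc j)"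
        and uv: "u = ?s [^]\<^bsub>Q\<^esub> Suc i \<otimes>\<^bsub>Q\<^esub> \<phi> a" "v = ?s [^]\<^bsub>Q\<^esub> Suc j \<otimes>\<^bsub>Q\<^esub> \<phi> b"
        unfolding F_def by blast
      note c = hpower_carrier[OF ab(1)] hpower_carrier[OF ab(2)]
      have "u \<otimes>\<^bsub>Q\<^esub> v = (?s [^]\<^bsub>Q\<^esub> Suc i \<otimes>\<^bsub>Q\<^esub> ?s [^]\<^bsub>Q\<^esub> Suc j) \<otimes>\<^bsub>Q\<^esub> \<phi> (a \<otimes> b)"
        unfolding uv using c s by (simp add: Q.m_ac)
      also have "\<dots> = ?s [^]\<^bsub>Q\<^esub> Suc (Suc (i + j)) \<otimes>\<^bsub>Q\<^esub> \<phi> (a \<otimes> b)"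
        using Q.nat_pow_mult[OF s, of "Suc i" "Suc j"] by simp
      also have "\<dots> \<in> F (Suc (i + j))" unfolding F_def using hpower_mult[OF I ab] by blast
      finally show "u \<otimes>\<^bsub>Q\<^esub> v \<in> M0" using FM0 by blast
    qed
  next
    fix a z assume "a \<in> \<phi> ` carrier R" and z: "z \<in> M0"
    then obtain x where x: "x \<in> carrier R" "a = \<phi> x" by blast
    from z obtain n where n: "z \<in> partial_hsum Q F n" unfolding M0_def by blast
    show "a \<otimes>\<^bsub>Q\<^esub> z \<in> M0"
    proof (rule Q.mult_partial_hsum_mem[of F, OF F M0 _ _ n])
      show "a \<in> carrier Q" using x by simp
      fix i u assume "u \<in> F i"
      then obtain b where b: "b \<in> hpower R I (Suc i)" "u = ?s [^]\<^bsub>Q\<^esub> Suc i \<otimes>\<^bsub>Q\<^esub> \<phi> b"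
        unfolding F_def by blast
      have "a \<otimes>\<^bsub>Q\<^esub> u = ?s [^]\<^bsub>Q\<^esub> Suc i \<otimes>\<^bsub>Q\<^esub> \<phi> (b \<otimes> x)"
        unfolding b(2) x(2) using hpower_carrier[OF b(1)] x(1) s by (simp add: Q.m_ac)
      moreover have "b \<otimes> x \<in> hpower R I (Suc i)"
        using hyperideal_hpower[OF I] b(1) x(1) by (simp add: hyperideal_iff del: hpower.simps)
      ultimately show "a \<otimes>\<^bsub>Q\<^esub> u \<in> M0" using FM0 unfolding F_def by blast
    qed
  qed
  moreover have "\<phi> ` carrier R \<subseteq> carrier Q" by auto
  ultimately obtain V M where V: "hypervaluation_hyperdomain V Q" "\<phi> ` carrier R \<subseteq> V"
    and M: "hsubgroup M Q" "M0 \<subseteq> M" "\<one>\<^bsub>Q\<^esub> \<notin> M" "\<And>v m. v \<in> V \<Longrightarrow> m \<in> M \<Longrightarrow> v \<otimes>\<^bsub>Q\<^esub> m \<in> M"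
    using Q.exists_hypervaluation by blast
  show ?thesis
  proof (rule that)
    show "V \<in> hypervaluations R" using V by (simp add: hypervaluations_def)
    show "\<phi> r \<notin> hyperideal_extension R I V"
    proof
      assume "\<phi> r \<in> hyperideal_extension R I V"
      then have "\<phi> r \<in> hprod Q (\<phi> ` I) V" by (simp add: hyperideal_extension_def)
      then have "?s \<otimes>\<^bsub>Q\<^esub> \<phi> r \<in> M"
      proof (rule Q.mult_hprod_mem[OF M(1) _ _ s, rotated 3])
        show "\<phi> ` I \<subseteq> carrier Q" using I_carrier by auto
        show "V \<subseteq> carrier Q" using Q.V_carrier[OF V(1)] by blast
        fix a v assume "a \<in> \<phi> ` I" and v: "v \<in> V"
        then obtain x where x: "x \<in> I" "a = \<phi> x" by blast
        have "?s \<otimes>\<^bsub>Q\<^esub> a \<in> F 0" unfolding F_def using x s by auto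
        then have "v \<otimes>\<^bsub>Q\<^esub> (?s \<otimes>\<^bsub>Q\<^esub> a) \<in> M" using FM0 M(2,4) v by blast
        moreover have "v \<otimes>\<^bsub>Q\<^esub> (?s \<otimes>\<^bsub>Q\<^esub> a) = ?s \<otimes>\<^bsub>Q\<^esub> (a \<otimes>\<^bsub>Q\<^esub> v)"
          using x s I_carrier Q.V_carrier[OF V(1) v] by (simp add: Q.m_ac)
        ultimately show "?s \<otimes>\<^bsub>Q\<^esub> (a \<otimes>\<^bsub>Q\<^esub> v) \<in> M" by simp
      qed
      then show False using M(3) Q.Units_l_inv[OF U] by simp
    qed
  qed
qed

lemma integral_closure_eq_Inter:
  "integral_closure R I =
    carrier R \<inter> (\<Inter>V \<in> hypervaluations R. hypercontraction R (hyperideal_extension R I V))"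
proof (intro equalityI subsetI)
  fix r assume r: "r \<in> integral_closure R I"
  then have "r \<in> carrier R" by (simp add: integral_closure_def)
  then show "r \<in> carrier R \<inter> (\<Inter>V \<in> hypervaluations R. hypercontraction R (hyperideal_extension R I V))"
    using integral_closure_subset_extension[OF r] by (simp add: hypercontraction_def)
next
  fix r assume "r \<in> carrier R \<inter> (\<Inter>V \<in> hypervaluations R. hypercontraction R (hyperideal_extension R I V))"
  then show "r \<in> integral_closure R I"
    using exists_hypervaluation_not_mem_extension[of r] by (auto simp: hypercontraction_def)
qed

end

end

text \<open>In the zero hyperring there are no fractions, so no hypervaluation hyperdomains, and the
  integral closure is everything.\<close>

lemma (in krasner_hyperring) integral_closure_zero_hyperring:
  assumes I: "hyperideal I R" and z: "\<one> = \<zero>"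
  shows "integral_closure R I = carrier R" "hypervaluations R = {}"
proof -
  have c: "carrier R = {\<zero>}"
    using z mult_hzero r_one hzero_closed by (metis is_singletonI' is_singleton_the_elem equals0D singletonD)
  have "\<zero> \<in> I" using I hsubgroup_zero by (simp add: hyperideal_iff)
  moreover have "\<zero> \<in> hsum_list R (\<zero> [^] (1::nat) # map (\<lambda>i. \<zero> \<otimes> \<zero> [^] (1 - i)) [1..<Suc 1])"
    by (simp add: hzero_closed mult_hzero hzero_hadd)
  ultimately have "\<zero> \<in> integral_closure R I"
    unfolding integral_closure_def using hzero_closed
    by (intro CollectI conjI exI[of _ "1::nat"] exI[of _ "\<lambda>i. \<zero>"]) auto
  moreover have "integral_closure R I \<subseteq> carrier R" by (auto simp: integral_closure_def)
  ultimately show "integral_closure R I = carrier R" using c by auto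
  have "carrier (quot_hyperfield R) = {}" by (simp add: quot_hyperfield_def c)
  then show "hypervaluations R = {}"
    unfolding hypervaluations_def hypervaluation_hyperdomain_def subhyperring_def by blast
qed

theorem theorem4p6:
  fixes R :: "('a, 'm) hyperring_scheme" and I :: "'a set"
  assumes "krasner_hyperdomain R"
    and "hyperideal I R"
  shows "integral_closure R I =
    carrier R \<inter> (\<Inter>V \<in> hypervaluations R. hypercontraction R (hyperideal_extension R I V))"
proof (cases "\<one>\<^bsub>R\<^esub> = \<zero>\<^bsub>R\<^esub>")
  case True
  interpret krasner_hyperdomain R by (rule assms)
  show ?thesis using integral_closure_zero_hyperring[OF assms(2) True] by simp
next
  case False
  then interpret nonzero_krasner_hyperdomain R
    using assms(1) by (simp add: nonzero_krasner_hyperdomain_def nonzero_krasner_hyperdomain_axioms_def)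
  show ?thesis by (rule integral_closure_eq_Inter[OF assms(2)])
qed

end
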